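(* Let $X$ be a uniformly locally finite metric space with property A, and let $h$ be a self-adjoint coarse operator on $\ell_2(X)$ such that $e^{ith}\mathrm{C}^*_u(X)e^{-ith}=\mathrm{C}^*_u(X)$ for all $t\in\mathbb{R}$. Then the map $E(h)\colon X\to\mathbb{R}$, $x\mapsto\langle h\delta_x,\delta_x\rangle$, is coarse, and the flow $\sigma_h$ on $\mathrm{C}^*_u(X)$, $\sigma_{h,t}(a)=e^{ith}ae^{-ith}$, is a cocycle perturbation of the diagonal flow $\sigma_{E(h)}$ (where $E(h)$ is regarded as a multiplication operator on $\ell_2(X)$). In particular $\sigma_h$ is a cocycle perturbation of a diagonal flow.
   Context: A metric space $(X,d)$ is uniformly locally finite if $\sup_x|B_r(x)|<\infty$ for all $r>0$. $(\delta_x)$ is the canonical basis of $\ell_2(X)$. A partial translation is a bijection $f\colon\mathrm{dom}(f)\subseteq X\to\mathrm{ran}(f)\subseteq X$ with $\sup_{x\in\mathrm{dom}(f)}d(x,f(x))<\infty$; $v_f\delta_x=\delta_{f(x)}$ for $x\in\mathrm{dom}(f)$, $v_f\delta_x=0$ otherwise. $\mathrm{C}^*_u(X)$ is the $\mathrm{C}^*$-algebra generated by all $v_f$. Property A: for all $\varepsilon,r>0$ there is $x\mapsto\xi_x$ into the unit sphere of $\ell_2(X)$ with $\|\xi_x-\xi_y\|\le\varepsilon$ when $d(x,y)\le r$ and $\sup\{d(x,y):\langle\xi_x,\delta_y\rangle\ne0\}<\infty$. A closed (possibly unbounded) operator $h$ is a coarse operator if $v_f(\mathrm{dom}(h))\subseteq\mathrm{dom}(h)$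 and $[h,v_f]=hv_f-v_fh$ is bounded on $\mathrm{dom}(h)$ for every partial translation $f$. A map $g\colon X\to\mathbb{R}$ is coarse if for every $r>0$ there is $s$ with $|g_x-g_z|\le s$ whenever $d(x,z)\le r$; a diagonal flow is one of the form $\sigma_g$ for $g$ a coarse map, viewed as a multiplication operator. For a pre-flow $\sigma$ on a unital $\mathrm{C}^*$-algebra $A$ (homomorphism $\mathbb{R}\to\mathrm{Aut}(A)$), a cocycle for $\sigma$ is a norm-continuous family of unitaries $(u_t)_{t\in\mathbb{R}}$ in $A$ with $u_{t+s}=u_t\sigma_t(u_s)$; $\rho$ is a cocycle perturbation of $\sigma$ if $\rho_t(a)=u_t\sigma_t(a)u_t^*$ for such a cocycle. *)

theory Defs
  imports "HOL-Analysis.Analysis"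
begin

type_synonym 'a vec = "'a \<Rightarrow> complex"
type_synonym 'a op = "'a vec \<Rightarrow> 'a vec"

definition l2 :: "'a vec set" where
  "l2 = {\<xi>. (\<lambda>x. (cmod (\<xi> x))^2) summable_on UNIV}"

definition l2norm :: "'a vec \<Rightarrow> real" where
  "l2norm \<xi> = sqrt (infsum (\<lambda>x. (cmod (\<xi> x))^2) UNIV)"

definition l2inner :: "'a vec \<Rightarrow> 'a vec \<Rightarrow> complex" where
  "l2inner \<xi> \<eta> = infsum (\<lambda>x. \<xi> x * cnj (\<eta> x)) UNIV"

definition delta :: "'a \<Rightarrow> 'a vec" where
  "delta x = (\<lambda>y. if y = x then 1 else 0)"

definition vdiff :: "'a vec \<Rightarrow> 'a vec \<Rightarrow> 'a vec" where
  "vdiff \<xi> \<eta> = (\<lambda>x. \<xi> x - \<eta> x)"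

text \<open>Operators are functions; only their values on l2 matter.\<close>
definition op_eq :: "'a op \<Rightarrow> 'a op \<Rightarrow> bool" where
  "op_eq T S \<longleftrightarrow> (\<forall>\<xi>\<in>l2. T \<xi> = S \<xi>)"

definition bounded_op :: "'a op \<Rightarrow> bool" where
  "bounded_op T \<longleftrightarrow>
     (\<forall>\<xi>\<in>l2. T \<xi> \<in> l2) \<and>
     (\<forall>\<xi>\<in>l2. \<forall>\<eta>\<in>l2. \<forall>c. T (\<lambda>x. c * \<xi> x + \<eta> x) = (\<lambda>x. c * T \<xi> x + T \<eta> x)) \<and>
     (\<exists>C. \<forall>\<xi>\<in>l2. l2norm (T \<xi>) \<le> C * l2norm \<xi>)"

definition opnorm :: "'a op \<Rightarrow> real" where
  "opnorm T = Sup {l2norm (T \<xi>) | \<xi>. \<xi> \<in> l2 \<and> l2norm \<xi> \<le> 1}"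

definition is_adjoint :: "'a op \<Rightarrow> 'a op \<Rightarrow> bool" where
  "is_adjoint T S \<longleftrightarrow> (\<forall>\<xi>\<in>l2. \<forall>\<eta>\<in>l2. l2inner (T \<xi>) \<eta> = l2inner \<xi> (S \<eta>))"

definition unitary_op :: "'a op \<Rightarrow> bool" where
  "unitary_op T \<longleftrightarrow> bounded_op T \<and>
     (\<exists>S. bounded_op S \<and> is_adjoint T S \<and> op_eq (T \<circ> S) id \<and> op_eq (S \<circ> T) id)"

definition partial_translation :: "'a::metric_space set \<Rightarrow> ('a \<Rightarrow> 'a) \<Rightarrow> bool" where
  "partial_translation D f \<longleftrightarrow> inj_on f D \<and> (\<exists>R. \<forall>x\<in>D. dist x (f x) \<le> R)"

definition vop :: "'a set \<Rightarrow> ('a \<Rightarrow> 'a) \<Rightarrow> 'a op" where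
  "vop D f \<xi> = (\<lambda>y. if y \<in> f ` D then \<xi> (the_inv_into D f y) else 0)"

definition roe_closed :: "'a::metric_space op set \<Rightarrow> bool" where
  "roe_closed A \<longleftrightarrow>
     (\<forall>D f. partial_translation D f \<longrightarrow> vop D f \<in> A) \<and>
     (\<forall>T\<in>A. bounded_op T) \<and>
     (\<forall>T\<in>A. \<forall>S\<in>A. (\<lambda>\<xi>. (\<lambda>x. T \<xi> x + S \<xi> x)) \<in> A) \<and>
     (\<forall>T\<in>A. \<forall>c. (\<lambda>\<xi>. (\<lambda>x. c * T \<xi> x)) \<in> A) \<and>
     (\<forall>T\<in>A. \<forall>S\<in>A. T \<circ> S \<in> A) \<and>
     (\<forall>T\<in>A. \<forall>S. bounded_op S \<and> is_adjoint T S \<longrightarrow> S \<in> A) \<and>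
     (\<forall>T. bounded_op T \<and> (\<forall>\<epsilon>>0. \<exists>S\<in>A. opnorm (\<lambda>\<xi>. vdiff (T \<xi>) (S \<xi>)) < \<epsilon>) \<longrightarrow> T \<in> A)"

definition uniform_roe :: "'a::metric_space op set" where
  "uniform_roe = \<Inter>{A. roe_closed A}"

definition unif_locally_finite :: "'a::metric_space itself \<Rightarrow> bool" where
  "unif_locally_finite _ \<longleftrightarrow>
     (\<forall>r>0. \<exists>N::nat. \<forall>x::'a. finite (cball x r) \<and> card (cball x r) \<le> N)"

definition property_A :: "'a::metric_space itself \<Rightarrow> bool" where
  "property_A _ \<longleftrightarrow>
     (\<forall>\<epsilon>>0. \<forall>r>0. \<exists>\<xi>::'a \<Rightarrow> 'a vec.
        (\<forall>x. \<xi> x \<in> l2 \<and> l2norm (\<xi> x) = 1) \<and>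
        (\<forall>x y. dist x y \<le> r \<longrightarrow> l2norm (vdiff (\<xi> x) (\<xi> y)) \<le> \<epsilon>) \<and>
        (\<exists>S. \<forall>x y. \<xi> x y \<noteq> 0 \<longrightarrow> dist x y \<le> S))"

text \<open>Unbounded operators are pairs (domain, function). Self-adjointness: h = h*.\<close>
definition self_adjoint_unb :: "'a vec set \<Rightarrow> 'a op \<Rightarrow> bool" where
  "self_adjoint_unb Dh h \<longleftrightarrow>
     Dh \<subseteq> l2 \<and>
     (\<forall>\<xi>\<in>l2. \<forall>\<epsilon>>0. \<exists>\<eta>\<in>Dh. l2norm (vdiff \<xi> \<eta>) < \<epsilon>) \<and>
     (\<forall>\<xi>\<in>Dh. h \<xi> \<in> l2) \<and>
     (\<forall>\<xi>\<in>Dh. \<forall>\<eta>\<in>Dh. \<forall>c. (\<lambda>x. c * \<xi> x + \<eta> x) \<in> Dh \<and>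
          h (\<lambda>x. c * \<xi> x + \<eta> x) = (\<lambda>x. c * h \<xi> x + h \<eta> x)) \<and>
     (\<forall>\<eta>\<in>l2. \<forall>\<zeta>\<in>l2.
        (\<forall>\<xi>\<in>Dh. l2inner (h \<xi>) \<eta> = l2inner \<xi> \<zeta>) \<longleftrightarrow> (\<eta> \<in> Dh \<and> h \<eta> = \<zeta>))"

definition coarse_operator :: "'a::metric_space vec set \<Rightarrow> 'a op \<Rightarrow> bool" where
  "coarse_operator Dh h \<longleftrightarrow>
     (\<forall>D f. partial_translation D f \<longrightarrow>
        vop D f ` Dh \<subseteq> Dh \<and>
        (\<exists>C. \<forall>\<xi>\<in>Dh. l2norm (vdiff (h (vop D f \<xi>)) (vop D f (h \<xi>))) \<le> C * l2norm \<xi>))"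

text \<open>U t = exp(i t h): U is a strongly continuous unitary group whose generator is i h
  (Stone's theorem: this determines U uniquely from the self-adjoint h).\<close>
definition is_exp_ith :: "'a vec set \<Rightarrow> 'a op \<Rightarrow> (real \<Rightarrow> 'a op) \<Rightarrow> bool" where
  "is_exp_ith Dh h U \<longleftrightarrow>
     (\<forall>t. unitary_op (U t)) \<and>
     op_eq (U 0) id \<and>
     (\<forall>s t. op_eq (U (s + t)) (U s \<circ> U t)) \<and>
     (\<forall>\<xi>\<in>l2. \<forall>t. ((\<lambda>s. l2norm (vdiff (U s \<xi>) (U t \<xi>))) \<longlongrightarrow> 0) (at t)) \<and>
     (\<forall>\<xi>\<in>l2. \<xi> \<in> Dh \<longleftrightarrow> (\<exists>\<zeta>\<in>l2.
        ((\<lambda>t. l2norm (\<lambda>x. (U t \<xi> x - \<xi> x) / of_real t - \<zeta> x)) \<longlongrightarrow> 0) (at 0))) \<and>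
     (\<forall>\<xi>\<in>Dh.
        ((\<lambda>t. l2norm (\<lambda>x. (U t \<xi> x - \<xi> x) / of_real t - \<i> * h \<xi> x)) \<longlongrightarrow> 0) (at 0))"

definition coarse_map :: "('a::metric_space \<Rightarrow> real) \<Rightarrow> bool" where
  "coarse_map g \<longleftrightarrow> (\<forall>r>0. \<exists>s. \<forall>x z. dist x z \<le> r \<longrightarrow> \<bar>g x - g z\<bar> \<le> s)"

definition mult_op :: "('a \<Rightarrow> complex) \<Rightarrow> 'a op" where
  "mult_op g \<xi> = (\<lambda>x. g x * \<xi> x)"

definition diag_flow :: "('a \<Rightarrow> real) \<Rightarrow> real \<Rightarrow> 'a op \<Rightarrow> 'a op" where
  "diag_flow g t a = mult_op (\<lambda>x. exp (\<i> * of_real (t * g x))) \<circ> a \<circ>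
                     mult_op (\<lambda>x. exp (- \<i> * of_real (t * g x)))"

text \<open>E(h): x maps to the inner product of h delta_x with delta_x (real since h is self-adjoint).\<close>
definition diag_exp :: "'a op \<Rightarrow> 'a \<Rightarrow> real" where
  "diag_exp h x = Re (l2inner (h (delta x)) (delta x))"

definition cocycle_perturbation ::
  "'a op set \<Rightarrow> (real \<Rightarrow> 'a op \<Rightarrow> 'a op) \<Rightarrow> (real \<Rightarrow> 'a op \<Rightarrow> 'a op) \<Rightarrow> bool" where
  "cocycle_perturbation A rh sig \<longleftrightarrow>
     (\<exists>u :: real \<Rightarrow> 'a op.
        (\<forall>t. u t \<in> A \<and> unitary_op (u t)) \<and>
        (\<forall>t. ((\<lambda>s. opnorm (\<lambda>\<xi>. vdiff (u s \<xi>) (u t \<xi>))) \<longlongrightarrow> 0) (at t)) \<and>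
        (\<forall>t s. op_eq (u (t + s)) (u t \<circ> sig t (u s))) \<and>
        (\<forall>t. \<forall>a\<in>A. \<forall>w. bounded_op w \<and> is_adjoint (u t) w \<longrightarrow>
             op_eq (rh t a) (u t \<circ> sig t a \<circ> w)))"

end

theory Submission
  imports Defs
begin

text \<open>Commutators of h with the projections onto subsets A of the space are bounded for every A, so by a
  Baire category argument on the power set they are uniformly bounded; averaging the conjugates of h
  over diagonal sign operators then shows that h - E(h) is bounded. Duhamel's formula gives
  norm (W t - 1) \<le> C |t| for W t = exp(i t h) exp(- i t E(h)), which is the cocycle; its norm
  continuity follows. It remains to see that U t = exp(i t h) lies in the uniform Roe algebra. For fixed
  t and e, all U t p U (- t) with p the projection onto a subset are, again by Baire category, within e
  of operators of one common propagation. Averaging U t a U (- t) a over diagonal sign operators a yields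
  that U t d is in the Roe algebra, where d is the diagonal part of U (- t). For small t the diagonal d
  is invertible because W t is near 1, so U t itself is in the algebra, and the group law extends this
  to all t.\<close>

section \<open>Square-summable vectors\<close>

text \<open>Everything runs through matrix entries and sums over finite sets, because
  \<open>h\<close> is unbounded and the averages over signs converge entrywise rather than in norm.
  Two closure properties make this sufficient. A common bound on all finite sections of a matrix
  survives entrywise limits, and for a bounded operator it bounds the norm. Being within e of a
  matrix supported at distance at most r also survives entrywise limits, by compactness, as long as
  r stays fixed. An estimate for each subset with its own constant is therefore useless for
  averaging; the category argument serves to make the constant independent of the subset.

  The invariance speaks of conjugates of \<open>U t\<close> only, while \<open>U t\<close> itself is
  wanted. Multiplying \<open>U t a U (- t)\<close> by the sign operator a once more, on the right,
  does not change its propagation, but turns the average over a into \<open>U t\<close> times the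
  conditional expectation of \<open>U (- t)\<close> onto the diagonal. One factor \<open>U t\<close>
  is thereby set free, and the other is reduced to a diagonal that can be divided out.\<close>

abbreviation fnorm :: "'a set \<Rightarrow> 'a vec \<Rightarrow> real" where
  "fnorm F \<xi> \<equiv> L2_set (\<lambda>x. cmod (\<xi> x)) F"

text \<open>The projection onto the vectors supported in \<open>A\<close>. It is \<open>vop\<close>
  of the identity on \<open>A\<close>, so it is a generator of the uniform Roe algebra and the
  coarseness of \<open>h\<close> applies to it.\<close>

definition restr :: "'a set \<Rightarrow> 'a vec \<Rightarrow> 'a vec" where
  "restr A \<xi> = (\<lambda>x. if x \<in> A then \<xi> x else 0)"

lemma l2norm_nonneg [simp]: "0 \<le> l2norm \<xi>"
  by (simp add: l2norm_def infsum_nonneg)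

lemma fnorm_square: "(fnorm F \<xi>)\<^sup>2 = (\<Sum>x\<in>F. (cmod (\<xi> x))\<^sup>2)"
  by (simp add: L2_set_def sum_nonneg)

text \<open>A bound on the finite partial norms yields membership and the norm estimate together, so
  that later estimates need only finite sums.\<close>

lemma
  assumes "\<And>F. finite F \<Longrightarrow> fnorm F \<xi> \<le> K"
  shows l2I: "\<xi> \<in> l2" and l2norm_leI: "l2norm \<xi> \<le> K"
proof -
  have K: "0 \<le> K" using assms[of "{}"] by simp
  have le: "(\<Sum>x\<in>F. (cmod (\<xi> x))\<^sup>2) \<le> K\<^sup>2" if "finite F" for F
    using assms[OF that] by (metis L2_set_nonneg fnorm_square power_mono)
  have s: "(\<lambda>x. (cmod (\<xi> x))\<^sup>2) summable_on UNIV"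
    by (rule nonneg_bdd_above_summable_on) (auto intro!: bdd_aboveI2 le)
  then show "\<xi> \<in> l2" by (simp add: l2_def)
  have "infsum (\<lambda>x. (cmod (\<xi> x))\<^sup>2) UNIV \<le> K\<^sup>2"
    using s by (rule infsum_le_finite_sums) (auto intro: le)
  then show "l2norm \<xi> \<le> K"
    unfolding l2norm_def using K real_le_lsqrt by auto
qed

lemma fnorm_le_l2norm:
  assumes "\<xi> \<in> l2" "finite F"
  shows "fnorm F \<xi> \<le> l2norm \<xi>"
  unfolding L2_set_def l2norm_def
  using assms by (auto intro!: real_sqrt_le_mono finite_sum_le_infsum simp: l2_def)

lemma cmod_le_l2norm:
  assumes "\<xi> \<in> l2"
  shows "cmod (\<xi> x) \<le> l2norm \<xi>"
  using fnorm_le_l2norm[OF assms, of "{x}"] by simp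

lemma fnorm_lin: "fnorm F (\<lambda>x. c * \<xi> x + \<eta> x) \<le> cmod c * fnorm F \<xi> + fnorm F \<eta>"
proof -
  have "fnorm F (\<lambda>x. c * \<xi> x + \<eta> x) \<le> L2_set (\<lambda>x. cmod c * cmod (\<xi> x) + cmod (\<eta> x)) F"
    by (intro L2_set_mono) (metis norm_mult norm_triangle_ineq, simp)
  also have "\<dots> \<le> L2_set (\<lambda>x. cmod c * cmod (\<xi> x)) F + fnorm F \<eta>"
    by (rule L2_set_triangle_ineq)
  finally show ?thesis by (simp add: L2_set_right_distrib)
qed

lemma l2norm_mono:
  assumes "\<eta> \<in> l2" "\<And>x. cmod (\<xi> x) \<le> cmod (\<eta> x)"
  shows "l2norm \<xi> \<le> l2norm \<eta>"
proof (rule l2norm_leI)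
  fix F :: "'a set" assume F: "finite F"
  have "fnorm F \<xi> \<le> fnorm F \<eta>" using assms(2) by (intro L2_set_mono) auto
  also have "\<dots> \<le> l2norm \<eta>" by (rule fnorm_le_l2norm[OF assms(1) F])
  finally show "fnorm F \<xi> \<le> l2norm \<eta>" .
qed

lemma
  assumes "\<xi> \<in> l2" "\<eta> \<in> l2"
  shows l2_lin: "(\<lambda>x. c * \<xi> x + \<eta> x) \<in> l2"
    and l2norm_lin: "l2norm (\<lambda>x. c * \<xi> x + \<eta> x) \<le> cmod c * l2norm \<xi> + l2norm \<eta>"
proof -
  have "fnorm F (\<lambda>x. c * \<xi> x + \<eta> x) \<le> cmod c * l2norm \<xi> + l2norm \<eta>" if "finite F" for F
    using fnorm_lin[of c \<xi> \<eta> F] fnorm_le_l2norm[OF assms(1) that] fnorm_le_l2norm[OF assms(2) that]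
    by (meson add_mono mult_left_mono norm_ge_zero order_trans)
  then show "(\<lambda>x. c * \<xi> x + \<eta> x) \<in> l2" "l2norm (\<lambda>x. c * \<xi> x + \<eta> x) \<le> cmod c * l2norm \<xi> + l2norm \<eta>"
    by (auto intro: l2I l2norm_leI)
qed

lemma l2_zero [simp]: "(\<lambda>x. 0) \<in> l2" and l2norm_zero [simp]: "l2norm (\<lambda>x. 0) = 0"
  by (simp_all add: l2_def l2norm_def)

lemma l2_add: "\<xi> \<in> l2 \<Longrightarrow> \<eta> \<in> l2 \<Longrightarrow> (\<lambda>x. \<xi> x + \<eta> x) \<in> l2"
  using l2_lin[of \<xi> \<eta> 1] by simp

lemma l2_scale: "\<xi> \<in> l2 \<Longrightarrow> (\<lambda>x. c * \<xi> x) \<in> l2"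
  using l2_lin[of \<xi> "\<lambda>x. 0" c] by simp

lemma l2_diff: "\<xi> \<in> l2 \<Longrightarrow> \<eta> \<in> l2 \<Longrightarrow> (\<lambda>x. \<xi> x - \<eta> x) \<in> l2"
  using l2_lin[of \<eta> \<xi> "-1"] by simp

lemma l2_vdiff: "\<xi> \<in> l2 \<Longrightarrow> \<eta> \<in> l2 \<Longrightarrow> vdiff \<xi> \<eta> \<in> l2"
  by (simp add: vdiff_def l2_diff)

lemma l2_sum: "(\<And>i. i \<in> I \<Longrightarrow> f i \<in> l2) \<Longrightarrow> (\<lambda>x. \<Sum>i\<in>I. f i x) \<in> l2"
  by (induction I rule: infinite_finite_induct) (auto intro: l2_add)

lemma l2norm_scale: "l2norm (\<lambda>x. c * \<xi> x) = cmod c * l2norm \<xi>"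
  by (simp add: l2norm_def norm_mult power_mult_distrib infsum_cmult_right' real_sqrt_mult)

lemma l2norm_add: "\<xi> \<in> l2 \<Longrightarrow> \<eta> \<in> l2 \<Longrightarrow> l2norm (\<lambda>x. \<xi> x + \<eta> x) \<le> l2norm \<xi> + l2norm \<eta>"
  using l2norm_lin[of \<xi> \<eta> 1] by simp

lemma l2norm_vdiff_triangle:
  assumes "\<xi> \<in> l2" "\<eta> \<in> l2" "\<zeta> \<in> l2"
  shows "l2norm (vdiff \<xi> \<zeta>) \<le> l2norm (vdiff \<xi> \<eta>) + l2norm (vdiff \<eta> \<zeta>)"
  using l2norm_add[of "vdiff \<xi> \<eta>" "vdiff \<eta> \<zeta>"] assms by (simp add: vdiff_def l2_diff)

lemma l2norm_le_vdiff:
  assumes "\<xi> \<in> l2" "\<eta> \<in> l2"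
  shows "l2norm \<xi> \<le> l2norm (vdiff \<xi> \<eta>) + l2norm \<eta>"
  using l2norm_vdiff_triangle[OF assms l2_zero] by (simp add: vdiff_def)

lemma
  assumes "finite F" "\<And>x. x \<notin> F \<Longrightarrow> \<xi> x = 0"
  shows l2_finite_support: "\<xi> \<in> l2" and l2norm_finite_support: "l2norm \<xi> = fnorm F \<xi>"
proof -
  have i: "(\<Sum>\<^sub>\<infinity>x. (cmod (\<xi> x))\<^sup>2) = (\<Sum>x\<in>F. (cmod (\<xi> x))\<^sup>2)"
    using assms by (subst infsum_cong_neutral[of F UNIV "\<lambda>x. (cmod (\<xi> x))\<^sup>2"]) auto
  show "\<xi> \<in> l2"
    using assms unfolding l2_def
    by (simp, subst summable_on_cong_neutral[of F UNIV "\<lambda>x. (cmod (\<xi> x))\<^sup>2" "\<lambda>x. (cmod (\<xi> x))\<^sup>2"]) auto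
  show "l2norm \<xi> = fnorm F \<xi>" by (simp add: l2norm_def L2_set_def i)
qed

lemma delta_apply: "delta x y = (if y = x then 1 else 0)"
  by (simp add: delta_def)

lemma delta_l2 [simp]: "delta x \<in> l2" and l2norm_delta [simp]: "l2norm (delta x) = 1"
  using l2_finite_support[of "{x}" "delta x"] l2norm_finite_support[of "{x}" "delta x"]
  by (auto simp: delta_def)

lemma restr_finite_l2: "finite F \<Longrightarrow> restr F \<xi> \<in> l2"
  and l2norm_restr_finite: "finite F \<Longrightarrow> l2norm (restr F \<xi>) = fnorm F \<xi>"
   apply (rule l2_finite_support[of F]; simp add: restr_def)
  apply (subst l2norm_finite_support[of F]; simp add: restr_def L2_set_def)
  done

lemma
  assumes "\<xi> \<in> l2"
  shows restr_l2: "restr A \<xi> \<in> l2" and l2norm_restr: "l2norm (restr A \<xi>) \<le> l2norm \<xi>"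
proof -
  have "fnorm F (restr A \<xi>) \<le> l2norm \<xi>" if "finite F" for F
    by (rule order_trans[OF L2_set_mono fnorm_le_l2norm[OF assms that]]) (auto simp: restr_def)
  then show "restr A \<xi> \<in> l2" "l2norm (restr A \<xi>) \<le> l2norm \<xi>" by (auto intro: l2I l2norm_leI)
qed

lemma restr_finite_sum: "finite F \<Longrightarrow> restr F \<xi> = (\<lambda>y. \<Sum>x\<in>F. \<xi> x * delta x y)"
  by (rule ext) (auto simp: restr_def delta_def if_distrib[of "\<lambda>t. _ * t"] sum.delta cong: if_cong)

lemma finite_tail:
  assumes "\<xi> \<in> l2" "0 < e"
  obtains F where "finite F" "\<And>G. finite G \<Longrightarrow> F \<inter> G = {} \<Longrightarrow> fnorm G \<xi> \<le> e"
proof -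
  let ?f = "\<lambda>x. (cmod (\<xi> x))\<^sup>2"
  have s: "?f summable_on UNIV" using assms by (simp add: l2_def)
  obtain F where F: "finite F" "dist (sum ?f F) (infsum ?f UNIV) \<le> e\<^sup>2"
    using infsum_finite_approximation[OF s, of "e\<^sup>2"] assms(2) by auto
  have "fnorm G \<xi> \<le> e" if "finite G" "F \<inter> G = {}" for G
  proof -
    have "sum ?f F + sum ?f G = sum ?f (F \<union> G)" using that F by (simp add: sum.union_disjoint)
    also have "\<dots> \<le> infsum ?f UNIV" using s F that by (intro finite_sum_le_infsum) auto
    finally have "sum ?f G \<le> e\<^sup>2" using F(2) by (simp add: dist_real_def)
    then show ?thesis unfolding L2_set_def using assms(2) by (simp add: real_le_lsqrt)
  qed
  with F(1) show ?thesis by (rule that)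
qed

lemma restr_approx:
  assumes "\<xi> \<in> l2" "0 < e"
  obtains F where "finite F" "\<And>A. F \<subseteq> A \<Longrightarrow> l2norm (vdiff \<xi> (restr A \<xi>)) \<le> e"
proof -
  obtain F where F: "finite F" "\<And>G. finite G \<Longrightarrow> F \<inter> G = {} \<Longrightarrow> fnorm G \<xi> \<le> e"
    using finite_tail[OF assms] by blast
  have "l2norm (vdiff \<xi> (restr A \<xi>)) \<le> e" if "F \<subseteq> A" for A
  proof (rule l2norm_leI)
    fix G :: "'a set" assume G: "finite G"
    have "fnorm G (vdiff \<xi> (restr A \<xi>)) = fnorm (G - A) \<xi>"
      unfolding L2_set_def
      by (rule arg_cong[where f=sqrt], rule sum.mono_neutral_cong_right) (use G in \<open>auto simp: vdiff_def restr_def\<close>)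
    also have "\<dots> \<le> e" by (rule F(2)) (use G that in auto)
    finally show "fnorm G (vdiff \<xi> (restr A \<xi>)) \<le> e" .
  qed
  with F(1) show ?thesis by (rule that)
qed

section \<open>The inner product\<close>

lemma l2_abs_summable:
  assumes "\<xi> \<in> l2" "\<eta> \<in> l2"
  shows "(\<lambda>x. norm (\<xi> x * cnj (\<eta> x))) summable_on UNIV"
    and "cmod (l2inner \<xi> \<eta>) \<le> l2norm \<xi> * l2norm \<eta>"
proof -
  have le: "(\<Sum>x\<in>F. norm (\<xi> x * cnj (\<eta> x))) \<le> l2norm \<xi> * l2norm \<eta>" if "finite F" for F
  proof -
    have "(\<Sum>x\<in>F. norm (\<xi> x * cnj (\<eta> x))) \<le> fnorm F \<xi> * fnorm F \<eta>"
      using L2_set_mult_ineq[of "\<lambda>x. cmod (\<xi> x)" "\<lambda>x. cmod (\<eta> x)" F] by (simp add: norm_mult)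
    also have "\<dots> \<le> l2norm \<xi> * l2norm \<eta>" by (intro mult_mono fnorm_le_l2norm assms that) auto
    finally show ?thesis .
  qed
  show a: "(\<lambda>x. norm (\<xi> x * cnj (\<eta> x))) summable_on UNIV"
    by (subst abs_summable_iff_bdd_above) (auto intro!: bdd_aboveI2 le)
  have "cmod (l2inner \<xi> \<eta>) \<le> infsum (\<lambda>x. norm (\<xi> x * cnj (\<eta> x))) UNIV"
    unfolding l2inner_def by (rule norm_infsum_bound[OF a])
  also have "\<dots> \<le> l2norm \<xi> * l2norm \<eta>"
    using a by (rule infsum_le_finite_sums) (auto intro: le)
  finally show "cmod (l2inner \<xi> \<eta>) \<le> l2norm \<xi> * l2norm \<eta>" .
qed

lemmas l2inner_bound = l2_abs_summable(2)
lemmas l2_summable = abs_summable_summable[OF l2_abs_summable(1)]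

lemma l2inner_lin_left:
  assumes "\<xi> \<in> l2" "\<eta> \<in> l2" "\<zeta> \<in> l2"
  shows "l2inner (\<lambda>x. c * \<xi> x + \<eta> x) \<zeta> = c * l2inner \<xi> \<zeta> + l2inner \<eta> \<zeta>"
proof -
  have "l2inner (\<lambda>x. c * \<xi> x + \<eta> x) \<zeta> = (\<Sum>\<^sub>\<infinity>x. c * (\<xi> x * cnj (\<zeta> x)) + \<eta> x * cnj (\<zeta> x))"
    unfolding l2inner_def by (rule infsum_cong) (simp add: algebra_simps)
  also have "\<dots> = c * l2inner \<xi> \<zeta> + l2inner \<eta> \<zeta>"
    unfolding l2inner_def
    by (subst infsum_add) (auto intro!: summable_on_cmult_right l2_summable assms simp: infsum_cmult_right')
  finally show ?thesis .
qed

lemma l2inner_cnj: "l2inner \<eta> \<xi> = cnj (l2inner \<xi> \<eta>)"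
  unfolding l2inner_def infsum_cnj[symmetric] by (simp add: mult.commute)

lemma l2inner_zero [simp]: "l2inner (\<lambda>x. 0) \<eta> = 0" "l2inner \<eta> (\<lambda>x. 0) = 0"
  by (simp_all add: l2inner_def)

lemma l2inner_lin_right:
  assumes "\<xi> \<in> l2" "\<eta> \<in> l2" "\<zeta> \<in> l2"
  shows "l2inner \<zeta> (\<lambda>x. c * \<xi> x + \<eta> x) = cnj c * l2inner \<zeta> \<xi> + l2inner \<zeta> \<eta>"
  using l2inner_lin_left[OF assms, of c] l2inner_cnj[of \<zeta>] by simp

lemma l2inner_vdiff_left:
  assumes "\<xi> \<in> l2" "\<eta> \<in> l2" "\<zeta> \<in> l2"
  shows "l2inner (vdiff \<xi> \<eta>) \<zeta> = l2inner \<xi> \<zeta> - l2inner \<eta> \<zeta>"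
  using l2inner_lin_left[OF assms(2,1,3), of "-1"] by (simp add: vdiff_def)

lemma l2inner_sum_left:
  assumes "\<And>i. i \<in> I \<Longrightarrow> f i \<in> l2" "\<zeta> \<in> l2"
  shows "l2inner (\<lambda>x. \<Sum>i\<in>I. c i * f i x) \<zeta> = (\<Sum>i\<in>I. c i * l2inner (f i) \<zeta>)"
  using assms(1)
proof (induction I rule: infinite_finite_induct)
  case (insert i I)
  then show ?case
    using l2inner_lin_left[of "f i" "\<lambda>x. \<Sum>i\<in>I. c i * f i x" \<zeta> "c i"] assms(2)
    by (auto simp: l2_sum l2_scale)
qed auto

lemma l2inner_finite_left:
  assumes "finite F" "\<And>x. x \<notin> F \<Longrightarrow> \<xi> x = 0"
  shows "l2inner \<xi> \<eta> = (\<Sum>x\<in>F. \<xi> x * cnj (\<eta> x))"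
  unfolding l2inner_def infsum_finite[OF assms(1), symmetric]
  by (rule infsum_cong_neutral) (use assms in auto)

lemma l2inner_finite_right:
  assumes "finite F" "\<And>x. x \<notin> F \<Longrightarrow> \<eta> x = 0"
  shows "l2inner \<xi> \<eta> = (\<Sum>x\<in>F. \<xi> x * cnj (\<eta> x))"
  by (subst l2inner_cnj, subst l2inner_finite_left[OF assms]) (auto simp: mult.commute)

lemma l2inner_delta_left [simp]: "l2inner (delta x) \<eta> = cnj (\<eta> x)"
  by (subst l2inner_finite_left[of "{x}"]) (auto simp: delta_def)

lemma l2inner_delta_right [simp]: "l2inner \<eta> (delta x) = \<eta> x"
  by (subst l2inner_cnj) simp

text \<open>Continuity of matrix coefficients of projections with respect to pointwise convergence
  of subsets, phrased for any family that agrees with \<open>A\<close> on larger and larger finite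
  sets. It makes the sets in the category argument closed.\<close>

lemma restr_inner_continuous:
  assumes \<xi>: "\<xi> \<in> l2" and \<eta>: "\<eta> \<in> l2"
    and A': "\<And>F. finite F \<Longrightarrow> A' F \<inter> F = A \<inter> F"
  shows "((\<lambda>F. l2inner (restr (A' F) \<xi>) \<eta>) \<longlongrightarrow> l2inner (restr A \<xi>) \<eta>) (finite_subsets_at_top UNIV)"
proof (rule tendstoI)
  fix e :: real assume e: "0 < e"
  have pos: "0 < l2norm \<eta> + 1" using l2norm_nonneg[of \<eta>] by linarith
  obtain F0 where F0: "finite F0" "\<And>S. F0 \<subseteq> S \<Longrightarrow> l2norm (vdiff \<xi> (restr S \<xi>)) \<le> e / (l2norm \<eta> + 1)"
    using restr_approx[OF \<xi>, of "e / (l2norm \<eta> + 1)"] e pos by auto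
  have "dist (l2inner (restr (A' F) \<xi>) \<eta>) (l2inner (restr A \<xi>) \<eta>) < e" if F: "finite F" "F0 \<subseteq> F" for F
  proof -
    \<comment> \<open>\<open>A' F\<close> and \<open>A\<close> can differ only outside
      \<open>F\<close>, so the error is dominated by the tail of \<open>\<xi>\<close>.\<close>
    have "cmod (vdiff (restr (A' F) \<xi>) (restr A \<xi>) x) \<le> cmod (vdiff \<xi> (restr F \<xi>) x)" for x
      using A'[OF F(1)] by (auto simp: vdiff_def restr_def)
    then have "l2norm (vdiff (restr (A' F) \<xi>) (restr A \<xi>)) \<le> l2norm (vdiff \<xi> (restr F \<xi>))"
      by (intro l2norm_mono l2_vdiff restr_l2 \<xi>)
    also have "\<dots> \<le> e / (l2norm \<eta> + 1)" by (rule F0(2)[OF F(2)])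
    finally have n: "l2norm (vdiff (restr (A' F) \<xi>) (restr A \<xi>)) \<le> e / (l2norm \<eta> + 1)" .
    have "dist (l2inner (restr (A' F) \<xi>) \<eta>) (l2inner (restr A \<xi>) \<eta>) = cmod (l2inner (vdiff (restr (A' F) \<xi>) (restr A \<xi>)) \<eta>)"
      by (simp add: dist_norm l2inner_vdiff_left restr_l2 \<xi> \<eta>)
    also have "\<dots> \<le> l2norm (vdiff (restr (A' F) \<xi>) (restr A \<xi>)) * l2norm \<eta>"
      by (intro l2inner_bound l2_vdiff restr_l2 \<xi> \<eta>)
    also have "\<dots> \<le> e / (l2norm \<eta> + 1) * l2norm \<eta>" by (intro mult_right_mono n) simp
    also have "\<dots> < e" using e pos by (simp add: field_simps)
    finally show ?thesis .
  qed
  with F0(1) show "\<forall>\<^sub>F F in finite_subsets_at_top UNIV. dist (l2inner (restr (A' F) \<xi>) \<eta>) (l2inner (restr A \<xi>) \<eta>) < e"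
    unfolding eventually_finite_subsets_at_top by (intro exI[of _ F0]) simp
qed

lemma l2inner_self:
  assumes "\<xi> \<in> l2"
  shows "l2inner \<xi> \<xi> = complex_of_real ((l2norm \<xi>)\<^sup>2)"
proof -
  have "l2inner \<xi> \<xi> = (\<Sum>\<^sub>\<infinity>x. complex_of_real ((cmod (\<xi> x))\<^sup>2))"
    unfolding l2inner_def by (simp only: complex_norm_square)
  also have "\<dots> = complex_of_real ((l2norm \<xi>)\<^sup>2)"
    using assms infsum_bounded_linear_strong[of complex_of_real "\<lambda>x. (cmod (\<xi> x))\<^sup>2" UNIV]
    summable_on_bounded_linear[OF bounded_linear_of_real, of "\<lambda>x. (cmod (\<xi> x))\<^sup>2" UNIV]
    by (simp add: l2norm_def infsum_nonneg l2_def bounded_linear_of_real)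
  finally show ?thesis .
qed

lemma l2norm_le_by_inner:
  assumes "\<xi> \<in> l2" "\<And>\<eta>. \<eta> \<in> l2 \<Longrightarrow> cmod (l2inner \<xi> \<eta>) \<le> K * l2norm \<eta>" "0 \<le> K"
  shows "l2norm \<xi> \<le> K"
proof -
  have "(l2norm \<xi>)\<^sup>2 \<le> K * l2norm \<xi>"
    using assms(2)[OF assms(1)] by (simp add: l2inner_self[OF assms(1)] norm_power)
  then show ?thesis
    using assms(3) l2norm_nonneg[of \<xi>] by (cases "l2norm \<xi> = 0") (auto simp: power2_eq_square)
qed

section \<open>Bounded operators\<close>

lemma bounded_op_l2: "bounded_op T \<Longrightarrow> \<xi> \<in> l2 \<Longrightarrow> T \<xi> \<in> l2"
  by (simp add: bounded_op_def)

lemma bounded_op_lin: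
  "bounded_op T \<Longrightarrow> \<xi> \<in> l2 \<Longrightarrow> \<eta> \<in> l2 \<Longrightarrow> T (\<lambda>x. c * \<xi> x + \<eta> x) = (\<lambda>x. c * T \<xi> x + T \<eta> x)"
  by (simp add: bounded_op_def)

lemma bounded_opE:
  assumes "bounded_op T"
  obtains C where "0 \<le> C" "\<And>\<xi>. \<xi> \<in> l2 \<Longrightarrow> l2norm (T \<xi>) \<le> C * l2norm \<xi>"
proof -
  obtain C where C: "\<And>\<xi>. \<xi> \<in> l2 \<Longrightarrow> l2norm (T \<xi>) \<le> C * l2norm \<xi>"
    using assms unfolding bounded_op_def by blast
  have "l2norm (T \<xi>) \<le> max C 0 * l2norm \<xi>" if "\<xi> \<in> l2" for \<xi>
    using C[OF that] mult_right_mono[of C "max C 0" "l2norm \<xi>"] by simp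
  then show ?thesis using that[of "max C 0"] by simp
qed

lemma bounded_opI:
  assumes "\<And>\<xi>. \<xi> \<in> l2 \<Longrightarrow> T \<xi> \<in> l2"
    and "\<And>\<xi> \<eta> c. \<xi> \<in> l2 \<Longrightarrow> \<eta> \<in> l2 \<Longrightarrow> T (\<lambda>x. c * \<xi> x + \<eta> x) = (\<lambda>x. c * T \<xi> x + T \<eta> x)"
    and "\<And>\<xi>. \<xi> \<in> l2 \<Longrightarrow> l2norm (T \<xi>) \<le> C * l2norm \<xi>"
  shows "bounded_op T"
  unfolding bounded_op_def using assms by blast

lemma bounded_op_zero: "bounded_op T \<Longrightarrow> T (\<lambda>x. 0) = (\<lambda>x. 0)"
  using bounded_op_lin[of T "\<lambda>x. 0" "\<lambda>x. 0" "-1"] by simp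

lemma bounded_op_scale: "bounded_op T \<Longrightarrow> \<xi> \<in> l2 \<Longrightarrow> T (\<lambda>x. c * \<xi> x) = (\<lambda>x. c * T \<xi> x)"
  using bounded_op_lin[of T \<xi> "\<lambda>x. 0" c] by (simp add: bounded_op_zero)

lemma bounded_op_diff: "bounded_op T \<Longrightarrow> \<xi> \<in> l2 \<Longrightarrow> \<eta> \<in> l2 \<Longrightarrow> T (vdiff \<xi> \<eta>) = vdiff (T \<xi>) (T \<eta>)"
  using bounded_op_lin[of T \<eta> \<xi> "-1"] by (simp add: vdiff_def)

lemma bounded_op_sum:
  assumes "bounded_op T" "\<And>i. i \<in> I \<Longrightarrow> f i \<in> l2"
  shows "T (\<lambda>x. \<Sum>i\<in>I. c i * f i x) = (\<lambda>x. \<Sum>i\<in>I. c i * T (f i) x)"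
  using assms(2)
proof (induction I rule: infinite_finite_induct)
  case (insert i I)
  then show ?case
    using bounded_op_lin[OF assms(1), of "f i" "\<lambda>x. \<Sum>i\<in>I. c i * f i x" "c i"]
    by (auto simp: l2_sum l2_scale)
qed (auto simp: bounded_op_zero[OF assms(1)])

lemma bounded_op_restr_finite:
  "bounded_op T \<Longrightarrow> finite F \<Longrightarrow> T (restr F \<xi>) = (\<lambda>y. \<Sum>x\<in>F. \<xi> x * T (delta x) y)"
  by (simp add: restr_finite_sum bounded_op_sum)

lemma bounded_op_comp:
  assumes "bounded_op T" "bounded_op S"
  shows "bounded_op (T \<circ> S)"
proof -
  obtain C where C: "0 \<le> C" "\<And>\<xi>. \<xi> \<in> l2 \<Longrightarrow> l2norm (T \<xi>) \<le> C * l2norm \<xi>"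
    using bounded_opE[OF assms(1)] by blast
  obtain D where D: "\<And>\<xi>. \<xi> \<in> l2 \<Longrightarrow> l2norm (S \<xi>) \<le> D * l2norm \<xi>"
    using bounded_opE[OF assms(2)] by blast
  show ?thesis
  proof (rule bounded_opI[of _ "C * D"])
    show "l2norm ((T \<circ> S) \<xi>) \<le> C * D * l2norm \<xi>" if "\<xi> \<in> l2" for \<xi>
      using C(2)[OF bounded_op_l2[OF assms(2) that]] mult_left_mono[OF D[OF that] C(1)]
      by (simp add: mult.assoc)
  qed (auto simp: bounded_op_l2 bounded_op_lin assms)
qed

lemma bounded_op_plus:
  assumes "bounded_op T" "bounded_op S"
  shows "bounded_op (\<lambda>\<xi> x. T \<xi> x + S \<xi> x)"
proof -
  obtain C where C: "\<And>\<xi>. \<xi> \<in> l2 \<Longrightarrow> l2norm (T \<xi>) \<le> C * l2norm \<xi>"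
    using bounded_opE[OF assms(1)] by blast
  obtain D where D: "\<And>\<xi>. \<xi> \<in> l2 \<Longrightarrow> l2norm (S \<xi>) \<le> D * l2norm \<xi>"
    using bounded_opE[OF assms(2)] by blast
  show ?thesis
  proof (rule bounded_opI[of _ "C + D"])
    show "l2norm (\<lambda>x. T \<xi> x + S \<xi> x) \<le> (C + D) * l2norm \<xi>" if "\<xi> \<in> l2" for \<xi>
      using l2norm_add[OF bounded_op_l2[OF assms(1) that] bounded_op_l2[OF assms(2) that]] C[OF that] D[OF that]
      by (simp add: distrib_right)
  qed (auto simp: bounded_op_l2 bounded_op_lin[OF assms(1)] bounded_op_lin[OF assms(2)] assms l2_add distrib_left)
qed

lemma bounded_op_times:
  assumes "bounded_op T"
  shows "bounded_op (\<lambda>\<xi> x. c * T \<xi> x)"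
proof -
  obtain C where C: "\<And>\<xi>. \<xi> \<in> l2 \<Longrightarrow> l2norm (T \<xi>) \<le> C * l2norm \<xi>"
    using bounded_opE[OF assms] by blast
  show ?thesis
  proof (rule bounded_opI[of _ "cmod c * C"])
    show "l2norm (\<lambda>x. c * T \<xi> x) \<le> cmod c * C * l2norm \<xi>" if "\<xi> \<in> l2" for \<xi>
      using C[OF that] by (simp add: l2norm_scale mult.assoc mult_left_mono)
  qed (auto simp: bounded_op_l2 bounded_op_lin[OF assms] assms l2_scale distrib_left mult.left_commute)
qed

lemma bounded_op_vdiff:
  assumes "bounded_op T" "bounded_op S"
  shows "bounded_op (\<lambda>\<xi>. vdiff (T \<xi>) (S \<xi>))"
  using bounded_op_plus[OF assms(1) bounded_op_times[OF assms(2), of "-1"]] by (simp add: vdiff_def)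

lemma bounded_op_cong:
  assumes "bounded_op T" "op_eq S T"
  shows "bounded_op S"
  using assms unfolding bounded_op_def op_eq_def by (simp add: l2_lin)

lemma bounded_op_id: "bounded_op id"
  by (rule bounded_opI[of _ 1]) auto

section \<open>The operator norm\<close>

lemma opnorm_le:
  assumes "\<And>\<xi>. \<xi> \<in> l2 \<Longrightarrow> l2norm (T \<xi>) \<le> K * l2norm \<xi>" "0 \<le> K"
  shows "opnorm T \<le> K"
  unfolding opnorm_def
proof (rule cSup_least)
  show "{l2norm (T \<xi>) |\<xi>. \<xi> \<in> l2 \<and> l2norm \<xi> \<le> 1} \<noteq> {}"
    by (auto intro: exI[of _ "\<lambda>x. 0"])
  show "y \<le> K" if "y \<in> {l2norm (T \<xi>) |\<xi>. \<xi> \<in> l2 \<and> l2norm \<xi> \<le> 1}" for y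
  proof -
    from that obtain \<xi> where \<xi>: "y = l2norm (T \<xi>)" "\<xi> \<in> l2" "l2norm \<xi> \<le> 1" by blast
    then show ?thesis using assms(1)[of \<xi>] mult_left_mono[OF \<xi>(3) assms(2)] by simp
  qed
qed

lemma le_opnorm:
  assumes "bounded_op T" "\<xi> \<in> l2"
  shows "l2norm (T \<xi>) \<le> opnorm T * l2norm \<xi>"
proof (cases "l2norm \<xi> = 0")
  case True
  obtain C where "l2norm (T \<xi>) \<le> C * l2norm \<xi>" using bounded_opE[OF assms(1)] assms(2) by blast
  with True show ?thesis by simp
next
  case False
  obtain C where C: "0 \<le> C" "\<And>\<xi>. \<xi> \<in> l2 \<Longrightarrow> l2norm (T \<xi>) \<le> C * l2norm \<xi>"
    using bounded_opE[OF assms(1)] by blast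
  define c where "c = complex_of_real (1 / l2norm \<xi>)"
  have c: "cmod c = 1 / l2norm \<xi>"
    unfolding c_def norm_of_real by simp
  have "l2norm (\<lambda>x. c * T \<xi> x) \<le> opnorm T"
    unfolding opnorm_def
  proof (rule cSup_upper)
    show "l2norm (\<lambda>x. c * T \<xi> x) \<in> {l2norm (T \<xi>) |\<xi>. \<xi> \<in> l2 \<and> l2norm \<xi> \<le> 1}"
      using False assms
      by (auto intro!: exI[of _ "\<lambda>x. c * \<xi> x"] simp: bounded_op_scale l2_scale l2norm_scale c)
    show "bdd_above {l2norm (T \<xi>) |\<xi>. \<xi> \<in> l2 \<and> l2norm \<xi> \<le> 1}"
    proof (rule bdd_aboveI[of _ C])
      fix y assume "y \<in> {l2norm (T \<xi>) |\<xi>. \<xi> \<in> l2 \<and> l2norm \<xi> \<le> 1}"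
      then obtain \<xi> where \<xi>: "y = l2norm (T \<xi>)" "\<xi> \<in> l2" "l2norm \<xi> \<le> 1" by blast
      then show "y \<le> C" using C(2)[of \<xi>] mult_left_mono[OF \<xi>(3) C(1)] by simp
    qed
  qed
  then have "l2norm (T \<xi>) / l2norm \<xi> \<le> opnorm T" by (simp add: l2norm_scale c)
  moreover have "0 < l2norm \<xi>" using False l2norm_nonneg[of \<xi>] by linarith
  ultimately show ?thesis by (simp add: pos_divide_le_eq)
qed

lemma opnorm_nonneg: "bounded_op T \<Longrightarrow> 0 \<le> opnorm T"
  using le_opnorm[of T "delta undefined"] l2norm_nonneg[of "T (delta undefined)"]
  by (simp del: l2norm_nonneg)

lemma is_adjoint_sym: "is_adjoint T S \<Longrightarrow> is_adjoint S T"
  unfolding is_adjoint_def by (metis l2inner_cnj)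

section \<open>Adjoints\<close>

lemma adjoint_entry:
  assumes "is_adjoint T S" "\<xi> \<in> l2"
  shows "T \<xi> y = l2inner \<xi> (S (delta y))"
  using assms by (metis delta_l2 is_adjoint_def l2inner_delta_right)

lemma adjoint_unique:
  assumes "is_adjoint T S" "is_adjoint T S'"
  shows "op_eq S S'"
proof -
  have "S \<xi> y = S' \<xi> y" if "\<xi> \<in> l2" for \<xi> y
    using adjoint_entry[OF is_adjoint_sym, of T _ \<xi> y] assms that by metis
  then show ?thesis by (auto simp: op_eq_def)
qed

lemma is_adjoint_comp:
  assumes "is_adjoint T T'" "is_adjoint S S'" "bounded_op S" "bounded_op T'"
  shows "is_adjoint (T \<circ> S) (S' \<circ> T')"
  using assms by (auto simp: is_adjoint_def bounded_op_l2)

lemma adjoint_norm_bound: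
  assumes "bounded_op T" "bounded_op S" "is_adjoint T S" "\<And>\<xi>. \<xi> \<in> l2 \<Longrightarrow> l2norm (T \<xi>) \<le> K * l2norm \<xi>"
    "\<xi> \<in> l2" "0 \<le> K"
  shows "l2norm (S \<xi>) \<le> K * l2norm \<xi>"
proof (rule l2norm_le_by_inner)
  show "S \<xi> \<in> l2" using assms bounded_op_l2 by blast
  show "0 \<le> K * l2norm \<xi>" using assms by simp
  fix \<eta> :: "'a vec" assume "\<eta> \<in> l2"
  have "cmod (l2inner (S \<xi>) \<eta>) = cmod (l2inner (T \<eta>) \<xi>)"
    using assms \<open>\<eta> \<in> l2\<close> by (metis complex_mod_cnj is_adjoint_def l2inner_cnj)
  also have "\<dots> \<le> l2norm (T \<eta>) * l2norm \<xi>"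
    using \<open>\<eta> \<in> l2\<close> assms by (intro l2inner_bound) (auto simp: bounded_op_l2)
  also have "\<dots> \<le> K * l2norm \<eta> * l2norm \<xi>"
    using assms(4)[OF \<open>\<eta> \<in> l2\<close>] by (intro mult_right_mono) auto
  finally show "cmod (l2inner (S \<xi>) \<eta>) \<le> K * l2norm \<xi> * l2norm \<eta>" by (simp add: mult_ac)
qed

section \<open>Kernels of operators\<close>

text \<open>The matrix of \<open>T\<close>, row index first. Only the values on basis vectors enter,
  so the notion also applies to the unbounded \<open>h\<close> once these vectors are known to lie
  in its domain.\<close>

definition ker :: "'a op \<Rightarrow> 'a \<Rightarrow> 'a \<Rightarrow> complex" where
  "ker T y x = T (delta x) y"

text \<open>The sesquilinear forms of all finite square sections have norm at most \<open>K\<close>.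
  No operator behind \<open>z\<close> is required, and each instance looks at finitely many entries;
  hence it suits commutators with \<open>h\<close> and passes to entrywise limits.\<close>

definition kbound :: "('a \<Rightarrow> 'a \<Rightarrow> complex) \<Rightarrow> real \<Rightarrow> bool" where
  "kbound z K \<longleftrightarrow> (\<forall>F \<xi> \<eta>. finite F \<longrightarrow>
     cmod (\<Sum>y\<in>F. \<Sum>x\<in>F. z y x * \<xi> x * cnj (\<eta> y)) \<le> K * fnorm F \<xi> * fnorm F \<eta>)"

lemma kboundD:
  "kbound z K \<Longrightarrow> finite F \<Longrightarrow>
    cmod (\<Sum>y\<in>F. \<Sum>x\<in>F. z y x * \<xi> x * cnj (\<eta> y)) \<le> K * fnorm F \<xi> * fnorm F \<eta>"
  by (simp add: kbound_def)

lemma ker_form: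
  assumes "bounded_op T" "finite F"
  shows "l2inner (T (restr F \<xi>)) (restr F \<eta>) = (\<Sum>y\<in>F. \<Sum>x\<in>F. ker T y x * \<xi> x * cnj (\<eta> y))"
  by (subst l2inner_finite_right[OF assms(2)])
    (auto simp: restr_def[of F \<eta>] bounded_op_restr_finite[OF assms] ker_def sum_distrib_left sum_distrib_right
      mult.commute intro!: sum.cong)

lemma kbound_ker:
  assumes "bounded_op T" "\<And>\<xi>. \<xi> \<in> l2 \<Longrightarrow> l2norm (T \<xi>) \<le> K * l2norm \<xi>"
  shows "kbound (ker T) K"
  unfolding kbound_def
proof (intro allI impI)
  fix F :: "'a set" and \<xi> \<eta> :: "'a vec" assume F: "finite F"
  have "cmod (\<Sum>y\<in>F. \<Sum>x\<in>F. ker T y x * \<xi> x * cnj (\<eta> y)) \<le> l2norm (T (restr F \<xi>)) * l2norm (restr F \<eta>)"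
    unfolding ker_form[OF assms(1) F, symmetric]
    by (intro l2inner_bound bounded_op_l2[OF assms(1)] restr_finite_l2 F)
  also have "\<dots> \<le> K * l2norm (restr F \<xi>) * l2norm (restr F \<eta>)"
    by (intro mult_right_mono assms restr_finite_l2 F) simp
  finally show "cmod (\<Sum>y\<in>F. \<Sum>x\<in>F. ker T y x * \<xi> x * cnj (\<eta> y)) \<le> K * fnorm F \<xi> * fnorm F \<eta>"
    by (simp add: l2norm_restr_finite[OF F])
qed

lemma kbound_nonneg: "kbound z K \<Longrightarrow> 0 \<le> K"
  using order_trans[OF norm_ge_zero kboundD[of z K "{undefined}" "\<lambda>x. 1" "\<lambda>x. 1"]] by simp

text \<open>The form is tested against the image vector itself. Since \<open>kbound\<close> knows
  square sections only, \<open>F\<close> and \<open>G\<close> are first embedded in their union and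
  the vectors extended by zero.\<close>

lemma kbound_column:
  assumes k: "kbound z K" and F: "finite F" and G: "finite G"
  shows "fnorm G (\<lambda>y. \<Sum>x\<in>F. z y x * \<xi> x) \<le> K * fnorm F \<xi>"
proof -
  define v where "v = (\<lambda>y. \<Sum>x\<in>F. z y x * \<xi> x)"
  define H where "H = F \<union> G"
  have H: "finite H" "F \<subseteq> H" "G \<subseteq> H" using F G by (auto simp: H_def)
  have r: "fnorm H (restr S \<zeta>) = fnorm S \<zeta>" if "S \<subseteq> H" for S \<zeta>
    unfolding L2_set_def
    by (rule arg_cong[where f=sqrt], rule sum.mono_neutral_cong_right) (use that H(1) in \<open>auto simp: restr_def\<close>)
  have "complex_of_real ((fnorm G v)\<^sup>2) = (\<Sum>y\<in>G. v y * cnj (v y))"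
    by (simp add: fnorm_square complex_norm_square[symmetric])
  also have "\<dots> = (\<Sum>y\<in>H. v y * cnj (restr G v y))"
    by (rule sum.mono_neutral_cong_left) (use H in \<open>auto simp: restr_def\<close>)
  also have "\<dots> = (\<Sum>y\<in>H. (\<Sum>x\<in>H. z y x * restr F \<xi> x) * cnj (restr G v y))"
  proof (rule sum.cong[OF refl])
    fix y
    have "v y = (\<Sum>x\<in>H. z y x * restr F \<xi> x)"
      unfolding v_def by (rule sum.mono_neutral_cong_left) (use H in \<open>auto simp: restr_def\<close>)
    then show "v y * cnj (restr G v y) = (\<Sum>x\<in>H. z y x * restr F \<xi> x) * cnj (restr G v y)" by simp
  qed
  also have "\<dots> = (\<Sum>y\<in>H. \<Sum>x\<in>H. z y x * restr F \<xi> x * cnj (restr G v y))"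
    by (simp add: sum_distrib_right)
  finally have e: "complex_of_real ((fnorm G v)\<^sup>2) = \<dots>" .
  have "(fnorm G v)\<^sup>2 = cmod (complex_of_real ((fnorm G v)\<^sup>2))" by (simp only: norm_of_real abs_power2)
  also have "\<dots> \<le> K * fnorm H (restr F \<xi>) * fnorm H (restr G v)"
    unfolding e by (rule kboundD[OF k H(1)])
  finally have 1: "(fnorm G v)\<^sup>2 \<le> K * fnorm F \<xi> * fnorm G v" using H by (simp only: r)
  have "fnorm G v \<le> K * fnorm F \<xi>"
  proof (cases "fnorm G v = 0")
    case True
    then show ?thesis using kbound_nonneg[OF k] by simp
  next
    case False
    then have "0 < fnorm G v" using L2_set_nonneg[of "\<lambda>x. cmod (v x)" G] by linarith
    with 1 show ?thesis by (simp add: power2_eq_square)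
  qed
  then show ?thesis by (simp add: v_def)
qed

text \<open>Finitely supported vectors obey the bound by \<open>kbound_column\<close>. The
  unspecified constant \<open>C\<close> from boundedness enters only the error of cutting off
  \<open>\<xi>\<close>, so it does not spoil \<open>K\<close>.\<close>

lemma l2norm_le_kbound:
  assumes T: "bounded_op T" "kbound (ker T) K" and \<xi>: "\<xi> \<in> l2"
  shows "l2norm (T \<xi>) \<le> K * l2norm \<xi>"
proof -
  have fin: "l2norm (T (restr F \<xi>)) \<le> K * l2norm \<xi>" if F: "finite F" for F
  proof (rule l2norm_leI)
    fix G :: "'a set" assume G: "finite G"
    have "fnorm G (T (restr F \<xi>)) \<le> K * fnorm F \<xi>"
      using kbound_column[OF T(2) F G, of \<xi>]
      by (simp add: bounded_op_restr_finite[OF T(1) F] ker_def mult.commute)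
    also have "\<dots> \<le> K * l2norm \<xi>" by (intro mult_left_mono fnorm_le_l2norm \<xi> F kbound_nonneg[OF T(2)])
    finally show "fnorm G (T (restr F \<xi>)) \<le> K * l2norm \<xi>" .
  qed
  obtain C where C: "0 \<le> C" "\<And>\<xi>. \<xi> \<in> l2 \<Longrightarrow> l2norm (T \<xi>) \<le> C * l2norm \<xi>"
    using bounded_opE[OF T(1)] by blast
  show ?thesis
  proof (rule field_le_epsilon)
    fix e :: real assume e: "0 < e"
    obtain F where F: "finite F" "\<And>A. F \<subseteq> A \<Longrightarrow> l2norm (vdiff \<xi> (restr A \<xi>)) \<le> e / (C + 1)"
      using restr_approx[OF \<xi>, of "e / (C + 1)"] e C by auto
    have r: "restr F \<xi> \<in> l2" by (rule restr_l2[OF \<xi>])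
    have "l2norm (T \<xi>) \<le> l2norm (vdiff (T \<xi>) (T (restr F \<xi>))) + l2norm (T (restr F \<xi>))"
      by (intro l2norm_le_vdiff bounded_op_l2[OF T(1)] \<xi> r)
    also have "\<dots> \<le> C * l2norm (vdiff \<xi> (restr F \<xi>)) + K * l2norm \<xi>"
      using C(2)[OF l2_vdiff[OF \<xi> r]] by (intro add_mono fin F) (simp add: bounded_op_diff[OF T(1) \<xi> r])
    also have "C * l2norm (vdiff \<xi> (restr F \<xi>)) \<le> C * (e / (C + 1))"
      by (intro mult_left_mono F C order_refl)
    also have "\<dots> \<le> e" using C e by (simp add: field_simps)
    finally show "l2norm (T \<xi>) \<le> K * l2norm \<xi> + e" by simp
  qed
qed

lemma kbound_mono:
  assumes "kbound z K" "K \<le> L"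
  shows "kbound z L"
  unfolding kbound_def
proof (intro allI impI)
  fix F :: "'a set" and \<xi> \<eta> :: "'a vec" assume "finite F"
  then have "cmod (\<Sum>y\<in>F. \<Sum>x\<in>F. z y x * \<xi> x * cnj (\<eta> y)) \<le> K * fnorm F \<xi> * fnorm F \<eta>"
    by (rule kboundD[OF assms(1)])
  also have "\<dots> \<le> L * fnorm F \<xi> * fnorm F \<eta>" by (intro mult_right_mono assms) auto
  finally show "cmod (\<Sum>y\<in>F. \<Sum>x\<in>F. z y x * \<xi> x * cnj (\<eta> y)) \<le> L * fnorm F \<xi> * fnorm F \<eta>" .
qed

lemma kbound_sum:
  fixes z :: "'i \<Rightarrow> 'a \<Rightarrow> 'a \<Rightarrow> complex"
  assumes "\<And>i. i \<in> I \<Longrightarrow> kbound (z i) (K i)"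
  shows "kbound (\<lambda>y x. \<Sum>i\<in>I. c i * z i y x) (\<Sum>i\<in>I. cmod (c i) * K i)"
  unfolding kbound_def
proof (intro allI impI)
  fix F :: "'a set" and \<xi> \<eta> :: "'a vec" assume F: "finite F"
  let ?s = "\<lambda>i. \<Sum>y\<in>F. \<Sum>x\<in>F. z i y x * \<xi> x * cnj (\<eta> y)"
  have "(\<Sum>y\<in>F. \<Sum>x\<in>F. (\<Sum>i\<in>I. c i * z i y x) * \<xi> x * cnj (\<eta> y)) =
      (\<Sum>y\<in>F. \<Sum>x\<in>F. \<Sum>i\<in>I. c i * (z i y x * \<xi> x * cnj (\<eta> y)))"
    by (simp add: sum_distrib_right mult.assoc)
  also have "\<dots> = (\<Sum>y\<in>F. \<Sum>i\<in>I. \<Sum>x\<in>F. c i * (z i y x * \<xi> x * cnj (\<eta> y)))"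
    by (intro sum.cong refl sum.swap)
  also have "\<dots> = (\<Sum>i\<in>I. \<Sum>y\<in>F. \<Sum>x\<in>F. c i * (z i y x * \<xi> x * cnj (\<eta> y)))"
    by (rule sum.swap)
  also have "\<dots> = (\<Sum>i\<in>I. c i * ?s i)" by (simp add: sum_distrib_left)
  also have "cmod \<dots> \<le> (\<Sum>i\<in>I. cmod (c i) * cmod (?s i))"
    by (rule order_trans[OF norm_sum]) (simp add: norm_mult)
  also have "\<dots> \<le> (\<Sum>i\<in>I. cmod (c i) * (K i * fnorm F \<xi> * fnorm F \<eta>))"
    by (intro sum_mono mult_left_mono kboundD assms F) auto
  also have "\<dots> = (\<Sum>i\<in>I. cmod (c i) * K i) * fnorm F \<xi> * fnorm F \<eta>"
    by (simp add: sum_distrib_right mult.assoc)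
  finally show "cmod (\<Sum>y\<in>F. \<Sum>x\<in>F. (\<Sum>i\<in>I. c i * z i y x) * \<xi> x * cnj (\<eta> y))
      \<le> (\<Sum>i\<in>I. cmod (c i) * K i) * fnorm F \<xi> * fnorm F \<eta>" .
qed

text \<open>Two terms are treated as a sum indexed by \<open>bool\<close>, with coefficients c and
  1.\<close>

lemma kbound_lin:
  assumes "kbound z K" "kbound w L"
  shows "kbound (\<lambda>y x. c * z y x + w y x) (cmod c * K + L)"
  using kbound_sum[of UNIV "case_bool z w" "case_bool K L" "case_bool c 1"] assms
  by (simp add: UNIV_bool add.commute split: bool.split)

lemma kbound_diag:
  assumes "kbound z K" "\<And>x. cmod (a x) \<le> 1"
  shows "kbound (\<lambda>y x. z y x * a x) K"
  unfolding kbound_def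
proof (intro allI impI)
  fix F :: "'a set" and \<xi> \<eta> :: "'a vec" assume F: "finite F"
  have "cmod (\<Sum>y\<in>F. \<Sum>x\<in>F. z y x * a x * \<xi> x * cnj (\<eta> y)) \<le> K * fnorm F (\<lambda>x. a x * \<xi> x) * fnorm F \<eta>"
    using kboundD[OF assms(1) F, of "\<lambda>x. a x * \<xi> x" \<eta>] by (simp add: mult.assoc)
  also have "\<dots> \<le> K * fnorm F \<xi> * fnorm F \<eta>"
    using kbound_nonneg[OF assms(1)] assms(2)
    by (intro mult_right_mono mult_left_mono L2_set_mono) (auto simp: norm_mult mult_left_le_one_le)
  finally show "cmod (\<Sum>y\<in>F. \<Sum>x\<in>F. z y x * a x * \<xi> x * cnj (\<eta> y)) \<le> K * fnorm F \<xi> * fnorm F \<eta>" .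
qed

lemma kbound_entry:
  assumes "kbound z K"
  shows "cmod (z y x) \<le> K"
proof -
  have "(\<Sum>v\<in>{x,y}. \<Sum>u\<in>{x,y}. z v u * delta x u * cnj (delta y v)) = z y x"
    by (cases "x = y") (simp_all add: delta_def)
  then have "cmod (z y x) \<le> K * fnorm {x,y} (delta x) * fnorm {x,y} (delta y)"
    using kboundD[OF assms, of "{x,y}" "delta x" "delta y"] by simp
  moreover have "fnorm {x,y} (delta x) = 1" "fnorm {x,y} (delta y) = 1"
    by (cases "x = y"; simp add: delta_def L2_set_def)+
  ultimately show ?thesis by simp
qed

lemma cmod_ker_le:
  assumes "\<And>\<xi>. \<xi> \<in> l2 \<Longrightarrow> T \<xi> \<in> l2 \<and> l2norm (T \<xi>) \<le> K * l2norm \<xi>"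
  shows "cmod (ker T y x) \<le> K"
  using cmod_le_l2norm[of "T (delta x)" y] assms[of "delta x"] by (simp add: ker_def)

section \<open>The uniform Roe algebra\<close>

lemma
  assumes "roe_closed A"
  shows roe_vop: "partial_translation D f \<Longrightarrow> vop D f \<in> A"
    and roe_bounded: "T \<in> A \<Longrightarrow> bounded_op T"
    and roe_add: "T \<in> A \<Longrightarrow> S \<in> A \<Longrightarrow> (\<lambda>\<xi> x. T \<xi> x + S \<xi> x) \<in> A"
    and roe_scale: "T \<in> A \<Longrightarrow> (\<lambda>\<xi> x. c * T \<xi> x) \<in> A"
    and roe_comp: "T \<in> A \<Longrightarrow> S \<in> A \<Longrightarrow> T \<circ> S \<in> A"
    and roe_adjoint: "T \<in> A \<Longrightarrow> bounded_op R \<Longrightarrow> is_adjoint T R \<Longrightarrow> R \<in> A"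
    and roe_limit: "bounded_op T \<Longrightarrow> (\<And>e. 0 < e \<Longrightarrow> \<exists>S\<in>A. opnorm (\<lambda>\<xi>. vdiff (T \<xi>) (S \<xi>)) < e) \<Longrightarrow> T \<in> A"
proof -
  note a = assms[unfolded roe_closed_def]
  note c = a[THEN conjunct2] note c = c c[THEN conjunct2] note c = c c(2)[THEN conjunct2]
    note c = c c(3)[THEN conjunct2] note c = c c(4)[THEN conjunct2]
  show "partial_translation D f \<Longrightarrow> vop D f \<in> A" by (rule a[THEN conjunct1, rule_format])
  show "T \<in> A \<Longrightarrow> bounded_op T" by (rule c(1)[THEN conjunct1, rule_format])
  show "T \<in> A \<Longrightarrow> S \<in> A \<Longrightarrow> (\<lambda>\<xi> x. T \<xi> x + S \<xi> x) \<in> A" by (rule c(2)[THEN conjunct1, rule_format])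
  show "T \<in> A \<Longrightarrow> (\<lambda>\<xi> x. c * T \<xi> x) \<in> A" by (rule c(3)[THEN conjunct1, rule_format])
  show "T \<in> A \<Longrightarrow> S \<in> A \<Longrightarrow> T \<circ> S \<in> A" by (rule c(4)[THEN conjunct1, rule_format])
  show "T \<in> A \<Longrightarrow> bounded_op R \<Longrightarrow> is_adjoint T R \<Longrightarrow> R \<in> A"
    by (rule c(5)[THEN conjunct1, rule_format]) auto
  show "bounded_op T \<Longrightarrow> (\<And>e. 0 < e \<Longrightarrow> \<exists>S\<in>A. opnorm (\<lambda>\<xi>. vdiff (T \<xi>) (S \<xi>)) < e) \<Longrightarrow> T \<in> A"
    using c(5)[THEN conjunct2] by blast
qed

text \<open>For injective \<open>f\<close> this is the adjoint of \<open>vop D f\<close>: the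
  translation by the inverse partial bijection, written without an inverse function.\<close>

definition vadj :: "'a set \<Rightarrow> ('a \<Rightarrow> 'a) \<Rightarrow> 'a op" where
  "vadj D f \<eta> = (\<lambda>x. if x \<in> D then \<eta> (f x) else 0)"

lemma
  assumes f: "inj_on f D"
  shows bounded_op_vop: "bounded_op (vop D f)"
    and bounded_op_vadj: "bounded_op (vadj D f)"
    and is_adjoint_vop: "is_adjoint (vop D f) (vadj D f)"
proof -
  have 1: "fnorm F (vop D f \<xi>) \<le> l2norm \<xi>" if \<xi>: "\<xi> \<in> l2" and F: "finite F" for F \<xi>
  proof -
    let ?E = "F \<inter> f ` D" and ?g = "the_inv_into D f"
    have i: "inj_on ?g ?E" by (rule inj_on_subset[OF inj_on_the_inv_into[OF f]]) auto
    have "fnorm F (vop D f \<xi>) = L2_set (\<lambda>y. cmod (\<xi> (?g y))) ?E"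
      unfolding L2_set_def
      by (rule arg_cong[where f=sqrt], rule sum.mono_neutral_cong_right) (use F in \<open>auto simp: vop_def\<close>)
    also have "\<dots> = fnorm (?g ` ?E) \<xi>" unfolding L2_set_def by (subst sum.reindex[OF i]) simp
    also have "\<dots> \<le> l2norm \<xi>" using F by (intro fnorm_le_l2norm \<xi>) auto
    finally show ?thesis .
  qed
  show "bounded_op (vop D f)"
    by (rule bounded_opI[of _ 1]) (use l2I[OF 1] l2norm_leI[OF 1] in \<open>simp_all\<close>, auto simp: vop_def)
  have 2: "fnorm F (vadj D f \<xi>) \<le> l2norm \<xi>" if \<xi>: "\<xi> \<in> l2" and F: "finite F" for F \<xi>
  proof -
    have i: "inj_on f (F \<inter> D)" by (rule inj_on_subset[OF f]) auto
    have "fnorm F (vadj D f \<xi>) = L2_set (\<lambda>y. cmod (\<xi> (f y))) (F \<inter> D)"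
      unfolding L2_set_def
      by (rule arg_cong[where f=sqrt], rule sum.mono_neutral_cong_right) (use F in \<open>auto simp: vadj_def\<close>)
    also have "\<dots> = fnorm (f ` (F \<inter> D)) \<xi>" unfolding L2_set_def by (subst sum.reindex[OF i]) simp
    also have "\<dots> \<le> l2norm \<xi>" using F by (intro fnorm_le_l2norm \<xi>) auto
    finally show ?thesis .
  qed
  show "bounded_op (vadj D f)"
    by (rule bounded_opI[of _ 1]) (use l2I[OF 2] l2norm_leI[OF 2] in \<open>simp_all\<close>, auto simp: vadj_def)
  show "is_adjoint (vop D f) (vadj D f)"
    unfolding is_adjoint_def
  proof (intro ballI)
    fix \<xi> \<eta> :: "'a vec"
    have "l2inner (vop D f \<xi>) \<eta> = (\<Sum>\<^sub>\<infinity>y\<in>f ` D. \<xi> (the_inv_into D f y) * cnj (\<eta> y))"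
      unfolding l2inner_def by (rule infsum_cong_neutral) (auto simp: vop_def)
    also have "\<dots> = (\<Sum>\<^sub>\<infinity>x\<in>D. \<xi> x * cnj (\<eta> (f x)))"
      by (subst infsum_reindex[OF f]) (auto intro!: infsum_cong simp: the_inv_into_f_f[OF f])
    also have "\<dots> = l2inner \<xi> (vadj D f \<eta>)"
      unfolding l2inner_def by (rule infsum_cong_neutral) (auto simp: vadj_def)
    finally show "l2inner (vop D f \<xi>) \<eta> = l2inner \<xi> (vadj D f \<eta>)" .
  qed
qed

lemma vop_delta:
  assumes "inj_on f D"
  shows "vop D f (delta x) y = (if x \<in> D \<and> y = f x then 1 else 0)"
  using assms by (auto simp: vop_def delta_def the_inv_into_f_f)

text \<open>Operators of propagation at most \<open>r\<close>. An adjoint is carried along as a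
  datum because it gives access to the rows of \<open>S\<close>: they are the conjugated columns of
  \<open>S'\<close>.\<close>

definition band :: "'a::metric_space op \<Rightarrow> 'a op \<Rightarrow> real \<Rightarrow> bool" where
  "band S S' r \<longleftrightarrow> bounded_op S \<and> bounded_op S' \<and> is_adjoint S S' \<and>
     (\<forall>x y. ker S y x \<noteq> 0 \<longrightarrow> dist x y \<le> r)"

lemma band_sym:
  assumes "band S S' r"
  shows "band S' S r"
proof -
  have "ker S' y x = cnj (ker S x y)" for x y
    using assms adjoint_entry[of S S' "delta y" x] by (simp add: band_def ker_def)
  moreover have "dist x y \<le> r" if "ker S x y \<noteq> 0" for x y
    using assms that by (subst dist_commute) (simp add: band_def)
  ultimately show ?thesis using assms by (simp add: band_def is_adjoint_sym)
qed

lemma adjoint_lin: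
  assumes "is_adjoint S S'" "is_adjoint T T'" "bounded_op S" "bounded_op T" "bounded_op S'" "bounded_op T'"
  shows "is_adjoint (\<lambda>\<xi> x. c * S \<xi> x + T \<xi> x) (\<lambda>\<xi> x. cnj c * S' \<xi> x + T' \<xi> x)"
  using assms by (simp add: is_adjoint_def l2inner_lin_left l2inner_lin_right bounded_op_l2)

lemma band_lin:
  assumes "band S S' r" "band T T' s"
  shows "band (\<lambda>\<xi> x. c * S \<xi> x + T \<xi> x) (\<lambda>\<xi> x. cnj c * S' \<xi> x + T' \<xi> x) (max r s)"
proof -
  have "dist x y \<le> max r s" if "c * ker S y x + ker T y x \<noteq> 0" for x y
  proof -
    have "ker S y x \<noteq> 0 \<or> ker T y x \<noteq> 0" using that by auto
    then show ?thesis using assms unfolding band_def by fastforce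
  qed
  then show ?thesis
    using assms unfolding band_def
    by (auto intro!: bounded_op_plus bounded_op_times adjoint_lin simp: ker_def)
qed

text \<open>An entry of the product is the inner product of a column of \<open>T\<close> and a
  column of \<open>S'\<close>; if it is nonzero, the two supports share a point \<open>z\<close>,
  and the triangle inequality applies.\<close>

lemma band_comp:
  assumes S: "band S S' r" and T: "band T T' s"
  shows "band (S \<circ> T) (T' \<circ> S') (r + s)"
proof -
  have "dist x y \<le> r + s" if nz: "ker (S \<circ> T) y x \<noteq> 0" for x y
  proof -
    have "ker (S \<circ> T) y x = l2inner (T (delta x)) (S' (delta y))"
      using S T adjoint_entry[of S S' "T (delta x)" y] by (simp add: band_def bounded_op_l2 ker_def)
    with nz obtain z where "T (delta x) z * cnj (S' (delta y) z) \<noteq> 0"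
      unfolding l2inner_def by (metis (mono_tags, lifting) infsum_0)
    then have "dist x z \<le> s" "dist y z \<le> r"
      using T band_sym[OF S] unfolding band_def ker_def by auto
    then show ?thesis using dist_triangle[of x y z] by (simp add: dist_commute)
  qed
  then show ?thesis using S T unfolding band_def by (auto intro!: bounded_op_comp is_adjoint_comp)
qed

text \<open>The norm closure of the operators of finite propagation. It is the concrete family that
  bounds the intersection \<open>uniform_roe\<close> from above.\<close>

definition band_dominated :: "'a::metric_space op \<Rightarrow> bool" where
  "band_dominated T \<longleftrightarrow> bounded_op T \<and> (\<forall>e>0. \<exists>S S' r. band S S' r \<and>
     (\<forall>\<xi>\<in>l2. l2norm (vdiff (T \<xi>) (S \<xi>)) \<le> e * l2norm \<xi>))"

lemma band_dominatedE:
  assumes "band_dominated T" "0 < e"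
  obtains S S' r where "band S S' r" "\<And>\<xi>. \<xi> \<in> l2 \<Longrightarrow> l2norm (vdiff (T \<xi>) (S \<xi>)) \<le> e * l2norm \<xi>"
  using assms unfolding band_dominated_def by blast

lemma band_imp_band_dominated: "band S S' r \<Longrightarrow> band_dominated S"
  unfolding band_dominated_def by (force simp: vdiff_def band_def)

lemma band_dominated_lin:
  assumes "band_dominated T1" "band_dominated T2"
  shows "band_dominated (\<lambda>\<xi> x. c * T1 \<xi> x + T2 \<xi> x)"
proof -
  have b: "bounded_op T1" "bounded_op T2" using assms by (auto simp: band_dominated_def)
  have "\<exists>S S' r. band S S' r \<and> (\<forall>\<xi>\<in>l2. l2norm (vdiff (\<lambda>x. c * T1 \<xi> x + T2 \<xi> x) (S \<xi>)) \<le> e * l2norm \<xi>)"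
    if e: "0 < e" for e
  proof -
    define d where "d = e / (cmod c + 1)"
    have c1: "cmod c + 1 > 0" by (smt (verit) norm_ge_zero)
    then have d: "0 < d" using e by (simp add: d_def)
    obtain S1 S1' r1 where 1: "band S1 S1' r1" "\<And>\<xi>. \<xi> \<in> l2 \<Longrightarrow> l2norm (vdiff (T1 \<xi>) (S1 \<xi>)) \<le> d * l2norm \<xi>"
      using band_dominatedE[OF assms(1) d] by blast
    obtain S2 S2' r2 where 2: "band S2 S2' r2" "\<And>\<xi>. \<xi> \<in> l2 \<Longrightarrow> l2norm (vdiff (T2 \<xi>) (S2 \<xi>)) \<le> d * l2norm \<xi>"
      using band_dominatedE[OF assms(2) d] by blast
    have "l2norm (vdiff (\<lambda>x. c * T1 \<xi> x + T2 \<xi> x) (\<lambda>x. c * S1 \<xi> x + S2 \<xi> x)) \<le> e * l2norm \<xi>"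
      if \<xi>: "\<xi> \<in> l2" for \<xi>
    proof -
      have s: "bounded_op S1" "bounded_op S2" using 1 2 by (auto simp: band_def)
      have "vdiff (\<lambda>x. c * T1 \<xi> x + T2 \<xi> x) (\<lambda>x. c * S1 \<xi> x + S2 \<xi> x)
          = (\<lambda>x. c * vdiff (T1 \<xi>) (S1 \<xi>) x + vdiff (T2 \<xi>) (S2 \<xi>) x)"
        by (simp add: vdiff_def algebra_simps)
      then have "l2norm (vdiff (\<lambda>x. c * T1 \<xi> x + T2 \<xi> x) (\<lambda>x. c * S1 \<xi> x + S2 \<xi> x))
          \<le> cmod c * l2norm (vdiff (T1 \<xi>) (S1 \<xi>)) + l2norm (vdiff (T2 \<xi>) (S2 \<xi>))"
        by (simp add: l2norm_lin l2_vdiff bounded_op_l2[OF _ \<xi>] b s)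
      also have "\<dots> \<le> cmod c * (d * l2norm \<xi>) + d * l2norm \<xi>"
        by (intro add_mono mult_left_mono 1 2 \<xi>) auto
      also have "\<dots> = (cmod c + 1) * d * l2norm \<xi>" by (simp add: algebra_simps)
      also have "(cmod c + 1) * d = e" using c1 by (simp add: d_def)
      finally show ?thesis .
    qed
    with band_lin[OF 1(1) 2(1)] show ?thesis by blast
  qed
  then show ?thesis unfolding band_dominated_def by (auto intro!: bounded_op_plus bounded_op_times b)
qed

lemma band_dominated_comp:
  assumes "band_dominated T1" "band_dominated T2"
  shows "band_dominated (T1 \<circ> T2)"
proof -
  have b: "bounded_op T1" "bounded_op T2" using assms by (auto simp: band_dominated_def)
  obtain C1 where C1: "0 \<le> C1" "\<And>\<xi>. \<xi> \<in> l2 \<Longrightarrow> l2norm (T1 \<xi>) \<le> C1 * l2norm \<xi>"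
    using bounded_opE[OF b(1)] by blast
  have "\<exists>S S' r. band S S' r \<and> (\<forall>\<xi>\<in>l2. l2norm (vdiff ((T1 \<circ> T2) \<xi>) (S \<xi>)) \<le> e * l2norm \<xi>)"
    if e: "0 < e" for e
  proof -
    define d where "d = e / 2 / (C1 + 1)"
    have d: "0 < d" using e C1 by (simp add: d_def)
    obtain S2 S2' r2 where 2: "band S2 S2' r2" "\<And>\<xi>. \<xi> \<in> l2 \<Longrightarrow> l2norm (vdiff (T2 \<xi>) (S2 \<xi>)) \<le> d * l2norm \<xi>"
      using band_dominatedE[OF assms(2) d] by blast
    then have s2: "bounded_op S2" by (simp add: band_def)
    obtain C2 where C2: "0 \<le> C2" "\<And>\<xi>. \<xi> \<in> l2 \<Longrightarrow> l2norm (S2 \<xi>) \<le> C2 * l2norm \<xi>"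
      using bounded_opE[OF s2] by blast
    \<comment> \<open>This tolerance can be fixed only now: it depends on the norm of the
      approximant \<open>S2\<close>, whereas \<open>d\<close> depended only on the norm of
      \<open>T1\<close>.\<close>
    define d' where "d' = e / 2 / (C2 + 1)"
    have d': "0 < d'" using e C2 by (simp add: d'_def)
    obtain S1 S1' r1 where 1: "band S1 S1' r1" "\<And>\<xi>. \<xi> \<in> l2 \<Longrightarrow> l2norm (vdiff (T1 \<xi>) (S1 \<xi>)) \<le> d' * l2norm \<xi>"
      using band_dominatedE[OF assms(1) d'] by blast
    then have s1: "bounded_op S1" by (simp add: band_def)
    have "l2norm (vdiff ((T1 \<circ> T2) \<xi>) ((S1 \<circ> S2) \<xi>)) \<le> e * l2norm \<xi>" if \<xi>: "\<xi> \<in> l2" for \<xi>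
    proof -
      note m = bounded_op_l2[OF b(1)] bounded_op_l2[OF b(2)] bounded_op_l2[OF s1] bounded_op_l2[OF s2] \<xi>
      have "l2norm (vdiff ((T1 \<circ> T2) \<xi>) ((S1 \<circ> S2) \<xi>))
          \<le> l2norm (vdiff (T1 (T2 \<xi>)) (T1 (S2 \<xi>))) + l2norm (vdiff (T1 (S2 \<xi>)) (S1 (S2 \<xi>)))"
        using l2norm_vdiff_triangle[of "T1 (T2 \<xi>)" "T1 (S2 \<xi>)" "S1 (S2 \<xi>)"] by (simp add: m)
      also have "l2norm (vdiff (T1 (T2 \<xi>)) (T1 (S2 \<xi>))) \<le> C1 * l2norm (vdiff (T2 \<xi>) (S2 \<xi>))"
        by (subst bounded_op_diff[OF b(1), symmetric]) (auto intro!: C1 l2_vdiff m)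
      also have "\<dots> \<le> C1 * (d * l2norm \<xi>)" by (intro mult_left_mono C1 2 \<xi>)
      also have "l2norm (vdiff (T1 (S2 \<xi>)) (S1 (S2 \<xi>))) \<le> d' * l2norm (S2 \<xi>)"
        by (intro 1 m)
      also have "\<dots> \<le> d' * (C2 * l2norm \<xi>)" using d' by (intro mult_left_mono C2 \<xi>) auto
      also have "C1 * (d * l2norm \<xi>) + d' * (C2 * l2norm \<xi>) = (C1 * d + C2 * d') * l2norm \<xi>"
        by (simp add: algebra_simps)
      also have "\<dots> \<le> e * l2norm \<xi>"
      proof (rule mult_right_mono)
        have "C1 * d \<le> e / 2" "C2 * d' \<le> e / 2" using C1 C2 e by (simp_all add: d_def d'_def field_simps)
        then show "C1 * d + C2 * d' \<le> e" by simp
      qed simp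
      finally show ?thesis by simp
    qed
    with band_comp[OF 1(1) 2(1)] show ?thesis by blast
  qed
  then show ?thesis unfolding band_dominated_def by (auto intro!: bounded_op_comp b)
qed

lemma band_dominated_adjoint:
  assumes "band_dominated T" "bounded_op R" "is_adjoint T R"
  shows "band_dominated R"
proof -
  have b: "bounded_op T" using assms by (auto simp: band_dominated_def)
  have "\<exists>S S' r. band S S' r \<and> (\<forall>\<xi>\<in>l2. l2norm (vdiff (R \<xi>) (S \<xi>)) \<le> e * l2norm \<xi>)" if e: "0 < e" for e
  proof -
    obtain S S' r where S: "band S S' r" "\<And>\<xi>. \<xi> \<in> l2 \<Longrightarrow> l2norm (vdiff (T \<xi>) (S \<xi>)) \<le> e * l2norm \<xi>"
      using band_dominatedE[OF assms(1) e] by blast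
    then have s: "bounded_op S" "bounded_op S'" "is_adjoint S S'" by (auto simp: band_def)
    \<comment> \<open>Taking adjoints preserves norm bounds, so the adjoint of the approximant
      approximates the adjoint equally well.\<close>
    have "is_adjoint (\<lambda>\<xi>. vdiff (T \<xi>) (S \<xi>)) (\<lambda>\<xi>. vdiff (R \<xi>) (S' \<xi>))"
      using adjoint_lin[OF s(3) assms(3), of "-1"] s b assms(2) by (simp add: vdiff_def)
    then have "l2norm (vdiff (R \<xi>) (S' \<xi>)) \<le> e * l2norm \<xi>" if "\<xi> \<in> l2" for \<xi>
      using e by (intro adjoint_norm_bound[OF bounded_op_vdiff[OF b s(1)] bounded_op_vdiff[OF assms(2) s(2)]] S(2) that) auto
    with band_sym[OF S(1)] show ?thesis by blast
  qed
  then show ?thesis unfolding band_dominated_def by (auto intro!: assms)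
qed

lemma band_dominated_limit:
  assumes T: "bounded_op T"
    and S: "\<And>e. 0 < e \<Longrightarrow> \<exists>S. band_dominated S \<and> opnorm (\<lambda>\<xi>. vdiff (T \<xi>) (S \<xi>)) < e"
  shows "band_dominated T"
proof -
  have "\<exists>S S' r. band S S' r \<and> (\<forall>\<xi>\<in>l2. l2norm (vdiff (T \<xi>) (S \<xi>)) \<le> e * l2norm \<xi>)" if e: "0 < e" for e
  proof -
    obtain R where R: "band_dominated R" "opnorm (\<lambda>\<xi>. vdiff (T \<xi>) (R \<xi>)) < e / 2"
      using S[of "e / 2"] e by auto
    then have r: "bounded_op R" by (simp add: band_dominated_def)
    obtain S S' r where S: "band S S' r" "\<And>\<xi>. \<xi> \<in> l2 \<Longrightarrow> l2norm (vdiff (R \<xi>) (S \<xi>)) \<le> e / 2 * l2norm \<xi>"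
      using band_dominatedE[OF R(1), of "e / 2"] e by auto
    have "l2norm (vdiff (T \<xi>) (S \<xi>)) \<le> e * l2norm \<xi>" if \<xi>: "\<xi> \<in> l2" for \<xi>
    proof -
      have "l2norm (vdiff (T \<xi>) (S \<xi>)) \<le> l2norm (vdiff (T \<xi>) (R \<xi>)) + l2norm (vdiff (R \<xi>) (S \<xi>))"
        using S(1) by (intro l2norm_vdiff_triangle) (auto simp: bounded_op_l2 \<xi> r T band_def)
      also have "\<dots> \<le> opnorm (\<lambda>\<xi>. vdiff (T \<xi>) (R \<xi>)) * l2norm \<xi> + e / 2 * l2norm \<xi>"
        by (intro add_mono le_opnorm[OF bounded_op_vdiff[OF T r]] S \<xi>)
      also have "\<dots> \<le> e / 2 * l2norm \<xi> + e / 2 * l2norm \<xi>"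
        using R(2) by (intro add_mono mult_right_mono) auto
      finally show ?thesis by simp
    qed
    with S(1) show ?thesis by blast
  qed
  then show ?thesis unfolding band_dominated_def using T by blast
qed

lemma band_vop:
  assumes "partial_translation D f"
  shows "\<exists>r. band (vop D f) (vadj D f) r"
proof -
  obtain R where R: "inj_on f D" "\<And>x. x \<in> D \<Longrightarrow> dist x (f x) \<le> R"
    using assms by (auto simp: partial_translation_def)
  then have "band (vop D f) (vadj D f) R"
    by (auto simp: band_def bounded_op_vop bounded_op_vadj is_adjoint_vop ker_def vop_delta split: if_splits)
  then show ?thesis ..
qed

lemma roe_closed_band_dominated: "roe_closed (Collect band_dominated)"
proof -
  have z: "band_dominated (\<lambda>\<xi> x. 0)"
    by (rule band_imp_band_dominated[of _ "\<lambda>\<xi> x. 0" 0])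
      (auto simp: band_def is_adjoint_def ker_def intro!: bounded_opI[of _ 0])
  show ?thesis
    unfolding roe_closed_def
  proof (intro conjI allI impI ballI; (elim conjE)?; unfold mem_Collect_eq)
    show "band_dominated (vop D f)" if "partial_translation D f" for D f
      using band_vop[OF that] band_imp_band_dominated by blast
    show "bounded_op T" if "band_dominated T" for T using that by (simp add: band_dominated_def)
    show "band_dominated (\<lambda>\<xi> x. T \<xi> x + S \<xi> x)" if "band_dominated T" "band_dominated S" for T S
      using band_dominated_lin[OF that, of 1] by simp
    show "band_dominated (\<lambda>\<xi> x. c * T \<xi> x)" if "band_dominated T" for T c
      using band_dominated_lin[OF that z, of c] by simp
    show "band_dominated (T \<circ> S)" if "band_dominated T" "band_dominated S" for T S
      using band_dominated_comp[OF that] .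
    show "band_dominated R" if "band_dominated T" "bounded_op R" "is_adjoint T R" for T R
      using band_dominated_adjoint[OF that] .
    show "band_dominated T"
      if "bounded_op T" "\<forall>e>0. \<exists>S\<in>Collect band_dominated. opnorm (\<lambda>\<xi>. vdiff (T \<xi>) (S \<xi>)) < e" for T
      using that by (intro band_dominated_limit) auto
  qed
qed

section \<open>The uniform Roe algebra as the smallest closed family\<close>

lemma uniform_roeI: "(\<And>A. roe_closed A \<Longrightarrow> T \<in> A) \<Longrightarrow> T \<in> uniform_roe"
  by (simp add: uniform_roe_def)

lemma uniform_roeD: "T \<in> uniform_roe \<Longrightarrow> roe_closed A \<Longrightarrow> T \<in> A"
  by (simp add: uniform_roe_def)

lemma band_dominated_uniform_roe: "T \<in> uniform_roe \<Longrightarrow> band_dominated T"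
  using uniform_roeD[OF _ roe_closed_band_dominated] by simp

text \<open>Closure properties pass to intersections. Boundedness of the members needs at least one
  closed family in the intersection, and the band dominated operators provide it.\<close>

lemma roe_closed_uniform_roe: "roe_closed uniform_roe"
  unfolding roe_closed_def
proof (intro conjI allI impI ballI; (elim conjE)?)
  show "bounded_op T" if "T \<in> uniform_roe" for T :: "'a op"
    using band_dominated_uniform_roe[OF that] by (simp add: band_dominated_def)
  show "vop D f \<in> uniform_roe" if "partial_translation D f" for D and f :: "'a \<Rightarrow> 'a"
    by (rule uniform_roeI) (rule roe_vop[OF _ that])
  show "(\<lambda>\<xi> x. T \<xi> x + S \<xi> x) \<in> uniform_roe" if "T \<in> uniform_roe" "S \<in> uniform_roe" for T S :: "'a op"
    by (rule uniform_roeI) (rule roe_add[OF _ uniform_roeD[OF that(1)] uniform_roeD[OF that(2)]])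
  show "(\<lambda>\<xi> x. c * T \<xi> x) \<in> uniform_roe" if "T \<in> uniform_roe" for T :: "'a op" and c
    by (rule uniform_roeI) (rule roe_scale[OF _ uniform_roeD[OF that(1)]])
  show "T \<circ> S \<in> uniform_roe" if "T \<in> uniform_roe" "S \<in> uniform_roe" for T S :: "'a op"
    by (rule uniform_roeI) (rule roe_comp[OF _ uniform_roeD[OF that(1)] uniform_roeD[OF that(2)]])
  show "R \<in> uniform_roe" if "T \<in> uniform_roe" "bounded_op R" "is_adjoint T R" for T R :: "'a op"
    by (rule uniform_roeI) (rule roe_adjoint[OF _ uniform_roeD[OF that(1)] that(2,3)])
  show "T \<in> uniform_roe"
    if T: "bounded_op T" "\<forall>e>0. \<exists>S\<in>uniform_roe. opnorm (\<lambda>\<xi>. vdiff (T \<xi>) (S \<xi>)) < e" for T :: "'a op"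
  proof (rule uniform_roeI)
    fix A :: "'a op set" assume A: "roe_closed A"
    show "T \<in> A"
    proof (rule roe_limit[OF A T(1)])
      fix e :: real assume "0 < e"
      then obtain S where "S \<in> uniform_roe" "opnorm (\<lambda>\<xi>. vdiff (T \<xi>) (S \<xi>)) < e" using T(2) by blast
      then show "\<exists>S\<in>A. opnorm (\<lambda>\<xi>. vdiff (T \<xi>) (S \<xi>)) < e" using uniform_roeD[OF _ A] by blast
    qed
  qed
qed

section \<open>Multiplication operators and band kernels\<close>

lemmas vop_roe = roe_vop[OF roe_closed_uniform_roe]
  and bounded_op_roe = roe_bounded[OF roe_closed_uniform_roe]
  and add_roe = roe_add[OF roe_closed_uniform_roe]
  and scale_roe = roe_scale[OF roe_closed_uniform_roe]
  and comp_roe = roe_comp[OF roe_closed_uniform_roe]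
  and limit_roe = roe_limit[OF roe_closed_uniform_roe]

lemma partial_translation_id: "partial_translation A (\<lambda>x. x)"
  by (auto simp: partial_translation_def)

lemma vop_id: "vop A (\<lambda>x. x) = restr A"
proof -
  have "the_inv_into A (\<lambda>x. x) y = y" if "y \<in> A" for y
    using the_inv_into_f_f[of "\<lambda>x. x" A y] that by simp
  then show ?thesis by (auto simp: vop_def restr_def fun_eq_iff)
qed

lemma restr_roe: "restr A \<in> uniform_roe"
  using vop_roe[OF partial_translation_id, of A] by (simp add: vop_id)

lemma sum_roe:
  assumes "\<And>i. i \<in> I \<Longrightarrow> T i \<in> uniform_roe"
  shows "(\<lambda>\<xi> x. \<Sum>i\<in>I. T i \<xi> x) \<in> uniform_roe"
proof -
  have z: "(\<lambda>\<xi> x. 0) \<in> uniform_roe" using scale_roe[OF restr_roe, of 0] by simp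
  show ?thesis
    using assms
  proof (induction I rule: infinite_finite_induct)
    case (insert i I)
    then show ?case using add_roe[of "T i" "\<lambda>\<xi> x. \<Sum>i\<in>I. T i \<xi> x"] by simp
  qed (simp_all add: z)
qed

text \<open>Operators that agree on \<open>l2\<close> have distance zero, so closedness under norm
  limits makes membership independent of the values elsewhere.\<close>

lemma roe_cong:
  assumes "T \<in> uniform_roe" "op_eq S T"
  shows "S \<in> uniform_roe"
proof (rule limit_roe[OF bounded_op_cong[OF bounded_op_roe[OF assms(1)] assms(2)]])
  fix e :: real assume "0 < e"
  have "opnorm (\<lambda>\<xi>. vdiff (S \<xi>) (T \<xi>)) \<le> 0"
    by (rule opnorm_le) (use assms(2) in \<open>simp_all add: op_eq_def vdiff_def\<close>)
  with assms(1) \<open>0 < e\<close> show "\<exists>R\<in>uniform_roe. opnorm (\<lambda>\<xi>. vdiff (S \<xi>) (R \<xi>)) < e"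
    by (intro bexI[of _ T]) auto
qed

lemma
  assumes "\<And>x. cmod (m x) \<le> K" "\<xi> \<in> l2"
  shows mult_op_l2: "mult_op m \<xi> \<in> l2" and l2norm_mult_op: "l2norm (mult_op m \<xi>) \<le> K * l2norm \<xi>"
proof -
  have K: "0 \<le> K" using assms(1) norm_ge_zero order_trans by blast
  have "fnorm F (mult_op m \<xi>) \<le> K * l2norm \<xi>" if "finite F" for F
  proof -
    have "fnorm F (mult_op m \<xi>) \<le> L2_set (\<lambda>x. K * cmod (\<xi> x)) F"
      by (intro L2_set_mono) (auto simp: mult_op_def norm_mult intro!: mult_right_mono assms)
    also have "\<dots> = K * fnorm F \<xi>" using K by (simp add: L2_set_right_distrib)
    also have "\<dots> \<le> K * l2norm \<xi>" by (intro mult_left_mono fnorm_le_l2norm assms that K)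
    finally show ?thesis .
  qed
  then show "mult_op m \<xi> \<in> l2" "l2norm (mult_op m \<xi>) \<le> K * l2norm \<xi>" by (auto intro: l2I l2norm_leI)
qed

lemma bounded_op_mult_op:
  assumes "\<And>x. cmod (m x) \<le> K"
  shows "bounded_op (mult_op m)"
  by (rule bounded_opI[of _ K])
    (simp_all add: mult_op_l2[OF assms] l2norm_mult_op[OF assms], simp add: mult_op_def algebra_simps)

lemma is_adjoint_mult_op: "is_adjoint (mult_op m) (mult_op (\<lambda>x. cnj (m x)))"
  by (simp add: is_adjoint_def l2inner_def mult_op_def mult_ac)

lemma mult_op_roe_finite_range:
  fixes s :: "'a::metric_space \<Rightarrow> complex"
  assumes "finite (range s)"
  shows "mult_op s \<in> uniform_roe"
proof -
  have "mult_op s = (\<lambda>\<xi> x. \<Sum>v\<in>range s. v * restr {x. s x = v} \<xi> x)"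
  proof (intro ext)
    fix \<xi> :: "'a vec" and x
    have "(\<Sum>v\<in>range s. v * restr {x. s x = v} \<xi> x) = (\<Sum>v\<in>range s. if v = s x then s x * \<xi> x else 0)"
      by (intro sum.cong) (auto simp: restr_def)
    also have "\<dots> = mult_op s \<xi> x" using assms by (simp add: mult_op_def)
    finally show "mult_op s \<xi> x = (\<Sum>v\<in>range s. v * restr {x. s x = v} \<xi> x)" ..
  qed
  also have "\<dots> \<in> uniform_roe" by (intro sum_roe scale_roe restr_roe)
  finally show ?thesis .
qed

lemma finite_floor_range:
  assumes "\<And>x. \<bar>f x\<bar> \<le> (K::real)"
  shows "finite (range (\<lambda>x. \<lfloor>f x\<rfloor>))"
proof (rule finite_subset)
  show "range (\<lambda>x. \<lfloor>f x\<rfloor>) \<subseteq> {\<lfloor>- K\<rfloor>..\<lfloor>K\<rfloor>}"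
    using assms by (auto intro!: floor_mono) (smt (verit))+
qed simp

text \<open>Rounding real and imaginary parts to multiples of \<open>d\<close> gives a symbol with
  finite range that is uniformly close to \<open>m\<close>.\<close>

lemma mult_op_roe:
  fixes m :: "'a::metric_space \<Rightarrow> complex"
  assumes m: "\<And>x. cmod (m x) \<le> K"
  shows "mult_op m \<in> uniform_roe"
proof (rule limit_roe[OF bounded_op_mult_op[OF m]])
  fix e :: real assume e: "0 < e"
  \<comment> \<open>Each of the two coordinates is off by at most \<open>d\<close>, so the total
    error is at most \<open>2 * d\<close>, half of e.\<close>
  define d where "d = e / 4"
  have d: "0 < d" using e by (simp add: d_def)
  define s where "s x = Complex (d * of_int \<lfloor>Re (m x) / d\<rfloor>) (d * of_int \<lfloor>Im (m x) / d\<rfloor>)" for x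
  have "finite (range (\<lambda>x. \<lfloor>Re (m x) / d\<rfloor>))" "finite (range (\<lambda>x. \<lfloor>Im (m x) / d\<rfloor>))"
    using order_trans[OF abs_Re_le_cmod m] order_trans[OF abs_Im_le_cmod m] d
    by (auto intro!: finite_floor_range[of _ "K / d"] simp: divide_right_mono)
  then have "finite ((\<lambda>(i, j). Complex (d * of_int i) (d * of_int j)) `
      (range (\<lambda>x. \<lfloor>Re (m x) / d\<rfloor>) \<times> range (\<lambda>x. \<lfloor>Im (m x) / d\<rfloor>)))" by simp
  then have "finite (range s)" by (rule finite_subset[rotated]) (auto simp: s_def)
  then have s: "mult_op s \<in> uniform_roe" by (rule mult_op_roe_finite_range)
  have rnd: "\<bar>a - d * of_int \<lfloor>a / d\<rfloor>\<bar> \<le> d" for a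
  proof -
    have "d * of_int \<lfloor>a / d\<rfloor> \<le> d * (a / d)" "d * (a / d) \<le> d * (of_int \<lfloor>a / d\<rfloor> + 1)"
      using d by (intro mult_left_mono; linarith)+
    then show ?thesis using d by (simp add: abs_le_iff algebra_simps)
  qed
  have ms: "cmod (m x - s x) \<le> 2 * d" for x
    using cmod_le[of "m x - s x"] rnd[of "Re (m x)"] rnd[of "Im (m x)"] by (simp add: s_def)
  have "opnorm (\<lambda>\<xi>. vdiff (mult_op m \<xi>) (mult_op s \<xi>)) \<le> 2 * d"
  proof (rule opnorm_le)
    fix \<xi> :: "'a vec" assume "\<xi> \<in> l2"
    then have "l2norm (mult_op (\<lambda>x. m x - s x) \<xi>) \<le> 2 * d * l2norm \<xi>"
      by (rule l2norm_mult_op[OF ms])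
    then show "l2norm (vdiff (mult_op m \<xi>) (mult_op s \<xi>)) \<le> 2 * d * l2norm \<xi>"
      by (simp add: mult_op_def vdiff_def left_diff_distrib)
  qed (use d in simp)
  also have "\<dots> < e" using e by (simp add: d_def)
  finally show "\<exists>S\<in>uniform_roe. opnorm (\<lambda>\<xi>. vdiff (mult_op m \<xi>) (S \<xi>)) < e" using s by blast
qed

text \<open>Numbering every ball of radius r by at most N numbers, a pair (x, y) at distance at most r is
  coloured by the number of y in the ball of x together with the number of x in the ball of y; each
  colour class is the graph of a partial translation.\<close>

lemma translation_cover:
  assumes ulf: "unif_locally_finite TYPE('a::metric_space)"
  obtains I :: "(nat \<times> nat) set" and D :: "nat \<times> nat \<Rightarrow> 'a::metric_space set"
    and f :: "nat \<times> nat \<Rightarrow> 'a \<Rightarrow> 'a"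
  where "finite I" "\<And>i. i \<in> I \<Longrightarrow> partial_translation (D i) (f i)"
    "\<And>i x. x \<in> D i \<Longrightarrow> dist x (f i x) \<le> r"
    "\<And>x y. dist x y \<le> r \<Longrightarrow> \<exists>!i. i \<in> I \<and> x \<in> D i \<and> y = f i x"
proof -
  \<comment> \<open>Bounded geometry is assumed for positive radii only, whence
    \<open>max r 1\<close>.\<close>
  obtain N where N: "\<And>x::'a. finite (cball x (max r 1)) \<and> card (cball x (max r 1)) \<le> N"
    using ulf unfolding unif_locally_finite_def by (metis less_max_iff_disj zero_less_one)
  have "\<exists>c. inj_on c (cball x r) \<and> c ` cball x r \<subseteq> {..<N}" for x :: 'a
  proof -
    have sub: "cball x r \<subseteq> cball x (max r 1)" by (rule subset_cball) simp
    then have fin: "finite (cball x r)" and card: "card (cball x r) \<le> N"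
      using N[of x] finite_subset card_mono[of "cball x (max r 1)" "cball x r"] by auto
    obtain c where "bij_betw c (cball x r) {0..<card (cball x r)}"
      using ex_bij_betw_finite_nat[OF fin] by blast
    then show ?thesis using card by (intro exI[of _ c]) (auto simp: bij_betw_def)
  qed
  then obtain c :: "'a \<Rightarrow> 'a \<Rightarrow> nat" where c: "\<And>x. inj_on (c x) (cball x r)" "\<And>x. c x ` cball x r \<subseteq> {..<N}"
    by metis
  define D where "D i = {x. \<exists>y. dist x y \<le> r \<and> i = (c x y, c y x)}" for i
  define f where "f i x = (SOME y. dist x y \<le> r \<and> i = (c x y, c y x))" for i x
  have f: "dist x (f i x) \<le> r \<and> i = (c x (f i x), c (f i x) x)" if "x \<in> D i" for i x
    using someI_ex[of "\<lambda>y. dist x y \<le> r \<and> i = (c x y, c y x)"] that by (simp add: D_def f_def)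
  \<comment> \<open>The first number of a colour and \<open>x\<close> determine \<open>y\<close>, so
    the choice in \<open>f\<close> is forced; the second number and \<open>y\<close> determine
    \<open>x\<close>, so \<open>f i\<close> is injective.\<close>
  have inj: "y = y'" if "dist x y \<le> r" "dist x y' \<le> r" "c x y = c x y'" for x y y'
    using that c(1)[of x] by (auto simp: inj_on_def)
  show ?thesis
  proof (rule that)
    show "finite ({..<N} \<times> {..<N})" by simp
    show "partial_translation (D i) (f i)" for i
      unfolding partial_translation_def
    proof (intro conjI exI ballI)
      show "inj_on (f i) (D i)"
        by (rule inj_onI) (metis f inj dist_commute prod.inject)
      show "dist x (f i x) \<le> r" if "x \<in> D i" for x using f[OF that] by simp
    qed
    show "dist x (f i x) \<le> r" if "x \<in> D i" for i x using f[OF that] by simp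
    show "\<exists>!i. i \<in> {..<N} \<times> {..<N} \<and> x \<in> D i \<and> y = f i x" if xy: "dist x y \<le> r" for x y
    proof (rule ex1I)
      let ?i = "(c x y, c y x)"
      have "y \<in> cball x r" "x \<in> cball y r" using xy by (simp_all add: dist_commute)
      then have "c x y < N" "c y x < N" using c(2) by blast+
      moreover have "x \<in> D ?i" using xy by (auto simp: D_def)
      moreover have "y = f ?i x" using f[OF \<open>x \<in> D ?i\<close>] inj[of x y "f ?i x"] xy by simp
      ultimately show "?i \<in> {..<N} \<times> {..<N} \<and> x \<in> D ?i \<and> y = f ?i x" by simp
      show "i = ?i" if "i \<in> {..<N} \<times> {..<N} \<and> x \<in> D i \<and> y = f i x" for i
        using f[of x i] that by simp
    qed
  qed
qed

text \<open>On each colour class the matrix is a weighted partial translation. Since a pair within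
  distance \<open>r\<close> has exactly one colour, the finitely many pieces add up to
  \<open>k\<close> without repetition.\<close>

lemma band_kernel_roe:
  fixes k :: "'a::metric_space \<Rightarrow> 'a \<Rightarrow> complex"
  assumes ulf: "unif_locally_finite TYPE('a)"
    and band: "\<And>x y. k y x \<noteq> 0 \<Longrightarrow> dist x y \<le> r"
    and bound: "\<And>x y. cmod (k y x) \<le> M"
  obtains T where "T \<in> uniform_roe" "ker T = k"
proof -
  obtain I and D :: "nat \<times> nat \<Rightarrow> 'a set" and f where I: "finite I"
    and pt: "\<And>i. i \<in> I \<Longrightarrow> partial_translation (D i) (f i)"
    and le: "\<And>i x. x \<in> D i \<Longrightarrow> dist x (f i x) \<le> r"
    and ex1: "\<And>x y. dist x y \<le> r \<Longrightarrow> \<exists>!i. i \<in> I \<and> x \<in> D i \<and> y = f i x"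
    using translation_cover[OF ulf, of r] by blast
  \<comment> \<open>The weight is indexed by the target point. Off the range of \<open>f i\<close>
    its value is arbitrary, but still bounded by \<open>M\<close>, and there \<open>vop\<close>
    vanishes.\<close>
  define m where "m i y = k y (the_inv_into (D i) (f i) y)" for i y
  define T where "T = (\<lambda>\<xi> y. \<Sum>i\<in>I. (mult_op (m i) \<circ> vop (D i) (f i)) \<xi> y)"
  have "T \<in> uniform_roe"
    unfolding T_def
    by (intro sum_roe comp_roe mult_op_roe[of _ M] vop_roe pt) (simp add: m_def bound)
  moreover have "ker T y x = k y x" for x y
  proof -
    have "ker T y x = (\<Sum>i\<in>I. if x \<in> D i \<and> y = f i x then k y x else 0)"
      unfolding ker_def T_def
    proof (rule sum.cong[OF refl])
      fix i assume "i \<in> I"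
      then have inj: "inj_on (f i) (D i)" using pt by (simp add: partial_translation_def)
      then show "(mult_op (m i) \<circ> vop (D i) (f i)) (delta x) y = (if x \<in> D i \<and> y = f i x then k y x else 0)"
        by (auto simp: mult_op_def vop_delta m_def the_inv_into_f_f)
    qed
    also have "\<dots> = k y x"
    proof (cases "dist x y \<le> r")
      case True
      then obtain j where j: "j \<in> I" "\<And>i. i \<in> I \<Longrightarrow> x \<in> D i \<and> y = f i x \<longleftrightarrow> i = j"
        using ex1 by metis
      have "(\<Sum>i\<in>I. if x \<in> D i \<and> y = f i x then k y x else 0) = (\<Sum>i\<in>I. if i = j then k y x else 0)"
        by (intro sum.cong refl) (simp add: j(2))
      then show ?thesis using j(1) I by simp
    next
      case False
      then have "k y x = 0" using band by blast
      then show ?thesis by (auto intro!: sum.neutral)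
    qed
    finally show ?thesis .
  qed
  ultimately show ?thesis using that by blast
qed

section \<open>Approximation by band kernels\<close>

text \<open>Both \<open>z\<close> and the approximant are mere matrices, so that the approximant may
  be obtained as a cluster point. Propagation and error are separate parameters because limits are
  taken with both fixed.\<close>

definition appr :: "('a::metric_space \<Rightarrow> 'a \<Rightarrow> complex) \<Rightarrow> real \<Rightarrow> real \<Rightarrow> bool" where
  "appr z r e \<longleftrightarrow> (\<exists>k. (\<forall>x y. k y x \<noteq> 0 \<longrightarrow> dist x y \<le> r) \<and> kbound (\<lambda>y x. z y x - k y x) e)"

lemma appr_mono: "appr z r e \<Longrightarrow> r \<le> s \<Longrightarrow> e \<le> d \<Longrightarrow> appr z s d"
  unfolding appr_def by (meson kbound_mono order_trans)

lemma appr_sum: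
  assumes "\<And>i. i \<in> I \<Longrightarrow> appr (z i) r (e i)"
  shows "appr (\<lambda>y x. \<Sum>i\<in>I. c i * z i y x) r (\<Sum>i\<in>I. cmod (c i) * e i)"
proof -
  obtain k where k: "\<And>i x y. i \<in> I \<Longrightarrow> k i y x \<noteq> 0 \<Longrightarrow> dist x y \<le> r"
    "\<And>i. i \<in> I \<Longrightarrow> kbound (\<lambda>y x. z i y x - k i y x) (e i)"
    using assms unfolding appr_def by metis
  have "kbound (\<lambda>y x. \<Sum>i\<in>I. c i * (z i y x - k i y x)) (\<Sum>i\<in>I. cmod (c i) * e i)"
    by (intro kbound_sum k)
  moreover have "dist x y \<le> r" if "(\<Sum>i\<in>I. c i * k i y x) \<noteq> 0" for x y
  proof -
    from that obtain i where "i \<in> I" "c i * k i y x \<noteq> 0" by (rule sum.not_neutral_contains_not_neutral)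
    then show ?thesis using k(1)[of i y x] by simp
  qed
  ultimately show ?thesis
    unfolding appr_def by (intro exI[of _ "\<lambda>y x. \<Sum>i\<in>I. c i * k i y x"]) (simp add: right_diff_distrib sum_subtractf)
qed

lemma appr_lin:
  assumes "appr z r e" "appr w r d"
  shows "appr (\<lambda>y x. c * z y x + w y x) r (cmod c * e + d)"
  using appr_sum[of UNIV "case_bool z w" r "case_bool e d" "case_bool c 1"] assms
  by (simp add: UNIV_bool add.commute split: bool.split)

lemma appr_diag:
  assumes "appr z r e" "\<And>x. cmod (a x) \<le> 1"
  shows "appr (\<lambda>y x. z y x * a x) r e"
proof -
  obtain k where k: "\<And>x y. k y x \<noteq> 0 \<Longrightarrow> dist x y \<le> r" "kbound (\<lambda>y x. z y x - k y x) e"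
    using assms(1) unfolding appr_def by blast
  show ?thesis
    unfolding appr_def
    using kbound_diag[OF k(2) assms(2)] k(1)
    by (intro exI[of _ "\<lambda>y x. k y x * a x"]) (auto simp: left_diff_distrib)
qed

lemma band_dominated_appr:
  assumes "band_dominated T" "0 < e"
  shows "\<exists>r. appr (ker T) r e"
proof -
  obtain S S' r where S: "band S S' r" "\<And>\<xi>. \<xi> \<in> l2 \<Longrightarrow> l2norm (vdiff (T \<xi>) (S \<xi>)) \<le> e * l2norm \<xi>"
    using band_dominatedE[OF assms] by blast
  have b: "bounded_op (\<lambda>\<xi>. vdiff (T \<xi>) (S \<xi>))"
    using S(1) assms(1) by (intro bounded_op_vdiff) (auto simp: band_def band_dominated_def)
  have "kbound (ker (\<lambda>\<xi>. vdiff (T \<xi>) (S \<xi>))) e" by (rule kbound_ker[OF b S(2)])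
  then have "appr (ker T) r e"
    unfolding appr_def using S(1) by (intro exI[of _ "ker S"]) (simp add: band_def ker_def[abs_def] vdiff_def)
  then show ?thesis ..
qed

text \<open>The converse of \<open>band_dominated_appr\<close> for elements of the algebra, resting
  on bounded geometry: the approximating matrix has bounded entries and finite propagation, hence
  belongs to an element of the algebra, and \<open>l2norm_le_kbound\<close> turns the matrix
  estimate into a norm estimate.\<close>

lemma appr_imp_roe:
  fixes T :: "'a::metric_space op"
  assumes ulf: "unif_locally_finite TYPE('a)" and T: "bounded_op T"
    and appr: "\<And>e. 0 < e \<Longrightarrow> \<exists>r. appr (ker T) r e"
  shows "T \<in> uniform_roe"
proof (rule limit_roe[OF T])
  fix e :: real assume e: "0 < e"
  obtain r where "appr (ker T) r (e / 2)" using appr[of "e / 2"] e by auto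
  then obtain k where k: "\<And>x y. k y x \<noteq> 0 \<Longrightarrow> dist x y \<le> r" "kbound (\<lambda>y x. ker T y x - k y x) (e / 2)"
    unfolding appr_def by blast
  obtain C where "\<And>\<xi>. \<xi> \<in> l2 \<Longrightarrow> l2norm (T \<xi>) \<le> C * l2norm \<xi>" using bounded_opE[OF T] by blast
  then have C: "cmod (ker T y x) \<le> C" for x y by (intro cmod_ker_le) (auto simp: bounded_op_l2 T)
  have "cmod (k y x) \<le> C + e / 2" for x y
    using norm_triangle_ineq4[of "ker T y x" "ker T y x - k y x"] C[of y x] kbound_entry[OF k(2), of y x]
    by simp
  then obtain S where S: "S \<in> uniform_roe" "ker S = k"
    using band_kernel_roe[OF ulf k(1)] by blast
  have "opnorm (\<lambda>\<xi>. vdiff (T \<xi>) (S \<xi>)) \<le> e / 2"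
  proof (rule opnorm_le)
    fix \<xi> :: "'a vec" assume "\<xi> \<in> l2"
    have "kbound (ker (\<lambda>\<xi>. vdiff (T \<xi>) (S \<xi>))) (e / 2)"
      using k(2) S(2)[symmetric] by (simp add: ker_def[abs_def] vdiff_def)
    then show "l2norm (vdiff (T \<xi>) (S \<xi>)) \<le> e / 2 * l2norm \<xi>"
      using e \<open>\<xi> \<in> l2\<close>
      by (intro l2norm_le_kbound[of "\<lambda>\<xi>. vdiff (T \<xi>) (S \<xi>)"] bounded_op_vdiff T bounded_op_roe[OF S(1)]) auto
  qed (use e in simp)
  also have "\<dots> < e" using e by simp
  finally show "\<exists>S\<in>uniform_roe. opnorm (\<lambda>\<xi>. vdiff (T \<xi>) (S \<xi>)) < e" using S(1) by blast
qed

text \<open>Subnets appear as finer proper filters: \<open>G\<close> is refined by the preimages of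
  the neighbourhoods of a cluster point of \<open>g\<close>.\<close>

lemma compact_cluster_filter:
  assumes "compact K" "\<And>i. g i \<in> K" "G \<noteq> bot"
  obtains f H where "H \<le> G" "H \<noteq> bot" "(g \<longlongrightarrow> f) H"
proof -
  have "filtermap g G \<noteq> bot" using assms(3) by (simp add: filtermap_bot_iff)
  moreover have "eventually (\<lambda>x. x \<in> K) (filtermap g G)"
    using assms(2) by (simp add: eventually_filtermap)
  ultimately obtain f where f: "inf (nhds f) (filtermap g G) \<noteq> bot"
    using assms(1) unfolding compact_filter by blast
  define H where "H = inf (filtercomap g (nhds f)) G"
  have "H \<noteq> bot"
  proof
    assume "H = bot"
    then have "eventually (\<lambda>x. False) H" by simp
    then obtain P Q where P: "eventually P (nhds f)" and Q: "eventually Q G" and PQ: "\<And>x. P (g x) \<Longrightarrow> Q x \<Longrightarrow> False"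
      unfolding H_def eventually_inf eventually_filtercomap by blast
    have "eventually (\<lambda>x. \<not> P x) (filtermap g G)"
      unfolding eventually_filtermap using Q by eventually_elim (use PQ in blast)
    with P have "eventually (\<lambda>x. False) (inf (nhds f) (filtermap g G))"
      unfolding eventually_inf by blast
    with f show False by (simp add: eventually_False)
  qed
  moreover have "(g \<longlongrightarrow> f) H"
    unfolding H_def by (rule filterlim_mono[OF filterlim_filtercomap]) auto
  ultimately show ?thesis using that[of H f] by (simp add: H_def)
qed

text \<open>The approximants of a convergent net of kernels have a cluster point, by Tychonoff's theorem.\<close>

lemma appr_limit:
  fixes Z :: "'i \<Rightarrow> 'a::metric_space \<Rightarrow> 'a \<Rightarrow> complex"
  assumes G: "G \<noteq> bot"
    and appr: "\<And>i. appr (Z i) r e" and bound: "\<And>i x y. cmod (Z i y x) \<le> M"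
    and lim: "\<And>x y. ((\<lambda>i. Z i y x) \<longlongrightarrow> z y x) G"
  shows "appr z r e"
proof -
  obtain k where k: "\<And>i x y. k i y x \<noteq> 0 \<Longrightarrow> dist x y \<le> r"
    "\<And>i. kbound (\<lambda>y x. Z i y x - k i y x) e"
    using appr unfolding appr_def by metis
  define g :: "'i \<Rightarrow> ('a \<times> 'a) \<Rightarrow> complex" where "g i = (\<lambda>(y, x). k i y x)" for i
  \<comment> \<open>Since \<open>Z\<close> has entries at most \<open>M\<close> and the error
    matrices have entries at most e, all approximants lie in one product of closed discs.\<close>
  define K :: "('a \<times> 'a \<Rightarrow> complex) set" where "K = PiE UNIV (\<lambda>_. cball 0 (M + e))"
  have "compactin (product_topology (\<lambda>_. euclidean) UNIV) K"
    unfolding K_def compactin_PiE by simp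
  then have "compact K" by (simp add: euclidean_product_topology)
  moreover have "g i \<in> K" for i
  proof -
    have "cmod (k i y x) \<le> M + e" for x y
      using norm_triangle_ineq4[of "Z i y x" "Z i y x - k i y x"] bound[of i y x] kbound_entry[OF k(2), of i y x]
      by simp
    then show ?thesis by (auto simp: K_def g_def split: prod.split)
  qed
  ultimately obtain f H where H: "H \<le> G" "H \<noteq> bot" "(g \<longlongrightarrow> f) H"
    using compact_cluster_filter[OF _ _ G] by metis
  have kf: "((\<lambda>i. k i y x) \<longlongrightarrow> f (y, x)) H" for x y
  proof -
    have "continuous_on UNIV (\<lambda>h::('a \<times> 'a) \<Rightarrow> complex. h (y, x))" by simp
    from continuous_on_tendsto_compose[OF this H(3)] show ?thesis by (simp add: g_def)
  qed
  have "dist x y \<le> r" if "f (y, x) \<noteq> 0" for x y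
  proof (rule ccontr)
    assume "\<not> dist x y \<le> r"
    then have "k i y x = 0" for i using k(1) by blast
    then have "f (y, x) = 0" using kf[of y x] tendsto_unique[OF H(2) _ tendsto_const] by simp
    with that show False ..
  qed
  moreover have "kbound (\<lambda>y x. z y x - f (y, x)) e"
    unfolding kbound_def
  proof (intro allI impI)
    fix F :: "'a set" and \<xi> \<eta> :: "'a vec" assume F: "finite F"
    have zH: "((\<lambda>i. Z i y x) \<longlongrightarrow> z y x) H" for x y using lim H(1) by (rule tendsto_mono[rotated])
    have "((\<lambda>i. cmod (\<Sum>y\<in>F. \<Sum>x\<in>F. (Z i y x - k i y x) * \<xi> x * cnj (\<eta> y)))
        \<longlongrightarrow> cmod (\<Sum>y\<in>F. \<Sum>x\<in>F. (z y x - f (y, x)) * \<xi> x * cnj (\<eta> y))) H"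
      by (intro tendsto_intros zH kf)
    then show "cmod (\<Sum>y\<in>F. \<Sum>x\<in>F. (z y x - f (y, x)) * \<xi> x * cnj (\<eta> y)) \<le> e * fnorm F \<xi> * fnorm F \<eta>"
      by (rule tendsto_upperbound) (auto intro!: always_eventually kboundD[OF k(2) F] H(2))
  qed
  ultimately show ?thesis unfolding appr_def by (intro exI[of _ "\<lambda>y x. f (y, x)"]) auto
qed

section \<open>A Baire category argument on the power set\<close>

text \<open>Baire's theorem for the power set with pointwise convergence. The cylinders
  \<open>{A. A \<inter> F = B}\<close> with finite \<open>F\<close> are the basic open sets, the
  first premise says that each \<open>P n\<close> is closed, and the claim is that some
  \<open>P n\<close> contains a cylinder. Otherwise one builds shrinking cylinders, the one after
  step n missing \<open>P n\<close>; the union of their traces then lies in no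
  \<open>P n\<close>.\<close>

lemma baire_power_set:
  fixes P :: "nat \<Rightarrow> 'a set \<Rightarrow> bool"
  assumes closed: "\<And>n A. (\<And>F. finite F \<Longrightarrow> \<exists>A'. A' \<inter> F = A \<inter> F \<and> P n A') \<Longrightarrow> P n A"
    and cover: "\<And>A. \<exists>n. P n A"
  shows "\<exists>n F B. finite F \<and> B \<subseteq> F \<and> (\<forall>A. A \<inter> F = B \<longrightarrow> P n A)"
proof (rule ccontr)
  assume neg': "\<not> ?thesis"
  have neg: "\<exists>A. A \<inter> F = B \<and> \<not> P n A" if "finite F" "B \<subseteq> F" for n F B
    using that neg' by blast
  let ?ok = "\<lambda>(F, B). finite F \<and> B \<subseteq> F"
  let ?next = "\<lambda>n (F, B) (F', B'). F \<subseteq> F' \<and> B' \<inter> F = B \<and> (\<forall>A. A \<inter> F' = B' \<longrightarrow> \<not> P n A)"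
  have "\<exists>h. \<forall>n::nat. ?ok (h n) \<and> ?next n (h n) (h (Suc n))"
  proof (rule dependent_nat_choice)
    show "\<exists>p. ?ok p" by auto
    fix p :: "'a set \<times> 'a set" and n :: nat assume p: "?ok p"
    obtain F B where FB: "p = (F, B)" by force
    obtain A where A: "A \<inter> F = B" "\<not> P n A" using neg[of F B n] p FB by auto
    \<comment> \<open>Closedness read contrapositively: a whole cylinder around \<open>A\<close>
      misses \<open>P n\<close>.\<close>
    obtain F' where F': "finite F'" "\<And>A'. A' \<inter> F' = A \<inter> F' \<Longrightarrow> \<not> P n A'"
      using closed[of A n] A(2) by blast
    have "\<not> P n A'" if "A' \<inter> (F \<union> F') = A \<inter> (F \<union> F')" for A'
      using that by (intro F'(2)) blast
    then have "?ok (F \<union> F', A \<inter> (F \<union> F')) \<and> ?next n p (F \<union> F', A \<inter> (F \<union> F'))"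
      using A(1) F'(1) p FB by auto
    then show "\<exists>q. ?ok q \<and> ?next n p q" by (rule exI)
  qed
  then obtain h where h: "\<forall>n::nat. ?ok (h n) \<and> ?next n (h n) (h (Suc n))" by (rule exE)
  define F B where "F n = fst (h n)" and "B n = snd (h n)" for n
  have FB: "B n \<subseteq> F n" "F n \<subseteq> F (Suc n)" "B (Suc n) \<inter> F n = B n"
    "\<And>A. A \<inter> F (Suc n) = B (Suc n) \<Longrightarrow> \<not> P n A" for n
    using h[rule_format, of n] by (auto simp: F_def B_def case_prod_beta)
  have mono: "F n \<subseteq> F m" if "n \<le> m" for n m using FB(2) that by (rule lift_Suc_mono_le[of F])
  have up: "B m \<inter> F n = B n" if "n \<le> m" for n m
    using that
  proof (induction rule: dec_induct)
    case base
    show ?case using FB(1) by blast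
  next
    case (step m)
    then have "B (Suc m) \<inter> F n = B (Suc m) \<inter> F m \<inter> F n" using mono[of n m] by blast
    also have "\<dots> = B n" using FB(3)[of m] step by simp
    finally show ?case .
  qed
  define A where "A = (\<Union>m. B m)"
  have "A \<inter> F n = B n" for n
  proof
    show "A \<inter> F n \<subseteq> B n"
    proof
      fix x assume "x \<in> A \<inter> F n"
      then obtain m where m: "x \<in> B m" "x \<in> F n" by (auto simp: A_def)
      show "x \<in> B n"
      proof (cases "n \<le> m")
        case True
        then show ?thesis using up[OF True] m by blast
      next
        case False
        then show ?thesis using up[of m n] m by auto
      qed
    qed
  qed (use FB(1) in \<open>auto simp: A_def\<close>)
  then have "\<not> P n A" for n using FB(4) by blast
  with cover[of A] show False by blast
qed

lemma indicator_decomp: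
  fixes B F :: "'a set"
  shows "indicator A x = indicator ((A - F) \<union> (B \<inter> F)) x - indicator (B \<inter> F) x + (indicator (A \<inter> F) x :: complex)"
  by (auto simp: indicator_def)

text \<open>Overwriting \<open>A\<close> on \<open>F\<close> by \<open>B\<close> moves it into the
  good cylinder, and the two correction terms are subsets of the finite set \<open>F\<close>.
  Whatever depends linearly on the indicator is thus controlled uniformly, at the price of three
  terms.\<close>

lemma uniform_over_subsets:
  fixes P :: "nat \<Rightarrow> 'a set \<Rightarrow> bool"
  assumes closed: "\<And>n A. (\<And>F. finite F \<Longrightarrow> \<exists>A'. A' \<inter> F = A \<inter> F \<and> P n A') \<Longrightarrow> P n A"
    and cover: "\<And>A. \<exists>n. P n A"
    and mono: "\<And>n m A. P n A \<Longrightarrow> n \<le> m \<Longrightarrow> P m A"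
  shows "\<exists>n. \<forall>A. \<exists>A1 A2 A3. P n A1 \<and> P n A2 \<and> P n A3 \<and>
    (\<forall>x. indicator A x = indicator A1 x - indicator A2 x + (indicator A3 x :: complex))"
proof -
  obtain n F B where F: "finite F" "B \<subseteq> F" "\<And>A. A \<inter> F = B \<Longrightarrow> P n A"
    using baire_power_set[of P, OF closed cover] by blast
  obtain N where N: "\<And>A. P (N A) A" using cover by metis
  \<comment> \<open>A common upper bound for the index of the cylinder and those of the finitely
    many subsets of \<open>F\<close>.\<close>
  define m where "m = n + (\<Sum>A\<in>Pow F. N A)"
  have le: "N A \<le> m" if "A \<subseteq> F" for A
    using member_le_sum[of A "Pow F" N] that F(1) by (simp add: m_def)
  have "P m ((A - F) \<union> (B \<inter> F)) \<and> P m (B \<inter> F) \<and> P m (A \<inter> F) \<and>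
    (\<forall>x. indicator A x = indicator ((A - F) \<union> (B \<inter> F)) x - indicator (B \<inter> F) x + (indicator (A \<inter> F) x :: complex))" for A
  proof (intro conjI allI indicator_decomp)
    have "((A - F) \<union> (B \<inter> F)) \<inter> F = B" using F(2) by blast
    from F(3)[OF this] show "P m ((A - F) \<union> (B \<inter> F))" by (rule mono) (simp add: m_def)
    show "P m (B \<inter> F)" by (rule mono[OF N le]) blast
    show "P m (A \<inter> F)" by (rule mono[OF N le]) blast
  qed
  then show ?thesis by blast
qed

section \<open>Averaging over signs\<close>

text \<open>The diagonal of the symmetry 1 - 2 p, where p is the projection onto
  \<open>A\<close>.\<close>

definition sgn_on :: "'a set \<Rightarrow> 'a \<Rightarrow> complex" where
  "sgn_on A x = (if x \<in> A then -1 else 1)"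

text \<open>For distinct points, toggling the membership of \<open>x\<close> pairs subsets of
  \<open>F\<close> with opposite signs. Only \<open>x\<close> has to lie in \<open>F\<close>;
  \<open>z\<close> may be anywhere, so that a whole infinite column can be averaged at once.\<close>

lemma sgn_on_average:
  assumes "finite F" "x \<in> F"
  shows "(\<Sum>A\<in>Pow F. 1 / 2 ^ card F * (sgn_on A x * sgn_on A z)) = (if x = z then 1 else 0)"
proof (cases "x = z")
  case True
  have "sgn_on A x * sgn_on A z = 1" for A using True by (simp add: sgn_on_def)
  then show ?thesis using True by (simp add: card_Pow assms)
next
  case False
  define t where "t A = (if x \<in> A then A - {x} else insert x A)" for A
  let ?f = "\<lambda>A. 1 / 2 ^ card F * (sgn_on A x * sgn_on A z)"
  have "sum ?f (Pow F) = (\<Sum>A\<in>Pow F. - ?f A)"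
    by (rule sum.reindex_bij_witness[of _ t t]) (use False assms in \<open>auto simp: t_def sgn_on_def\<close>)
  then have "sum ?f (Pow F) = - sum ?f (Pow F)" by (simp only: sum_negf)
  then show ?thesis using False by simp
qed

text \<open>With s the sign operator of \<open>A\<close>, the matrix \<open>w A\<close> is H - s H
  s, and it equals -2 times the commutator with the projection, times s. Averaging over the signs on
  \<open>F\<close> keeps the bound and deletes exactly the diagonal of \<open>H\<close>.\<close>

lemma kbound_off_diagonal:
  assumes "\<And>A. kbound (\<lambda>y x. H y x * (indicator A x - indicator A y)) C"
  shows "kbound (\<lambda>y x. if x = y then 0 else H y x) (2 * C)"
  unfolding kbound_def
proof (intro allI impI)
  fix F :: "'a set" and \<xi> \<eta> :: "'a vec" assume F: "finite F"
  define w where "w A y x = -2 * (H y x * (indicator A x - indicator A y)) * sgn_on A x" for A y x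
  have C: "0 \<le> C" using kbound_nonneg[OF assms] .
  have "kbound (w A) (2 * C)" for A
    unfolding w_def using kbound_sum[of "{()}" _ "\<lambda>_. C" "\<lambda>_. -2", OF assms]
    by (intro kbound_diag) (auto simp: sgn_on_def)
  then have "kbound (\<lambda>y x. \<Sum>A\<in>Pow F. 1 / 2 ^ card F * w A y x) (\<Sum>A\<in>Pow F. cmod (1 / 2 ^ card F) * (2 * C))"
    by (intro kbound_sum)
  then have k: "kbound (\<lambda>y x. \<Sum>A\<in>Pow F. 1 / 2 ^ card F * w A y x) (2 * C)"
    by (simp add: card_Pow F norm_divide norm_power)
  have w: "(\<Sum>A\<in>Pow F. 1 / 2 ^ card F * w A y x) = (if x = y then 0 else H y x)" if "x \<in> F" for x y
  proof -
    have "w A y x = H y x * (1 - sgn_on A x * sgn_on A y)" for A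
      by (auto simp: w_def sgn_on_def indicator_def)
    then have "(\<Sum>A\<in>Pow F. 1 / 2 ^ card F * w A y x) =
        H y x * ((\<Sum>A\<in>Pow F. 1 / 2 ^ card F) - (\<Sum>A\<in>Pow F. 1 / 2 ^ card F * (sgn_on A x * sgn_on A y)))"
      by (simp add: sum_distrib_left right_diff_distrib sum_subtractf mult_ac)
    also have "(\<Sum>A\<in>Pow F. 1 / 2 ^ card F) = (1::complex)" by (simp add: card_Pow F)
    finally show ?thesis by (simp only: sgn_on_average[OF F that]) simp
  qed
  have "(\<Sum>y\<in>F. \<Sum>x\<in>F. (if x = y then 0 else H y x) * \<xi> x * cnj (\<eta> y)) =
      (\<Sum>y\<in>F. \<Sum>x\<in>F. (\<Sum>A\<in>Pow F. 1 / 2 ^ card F * w A y x) * \<xi> x * cnj (\<eta> y))"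
    by (intro sum.cong refl) (simp only: w)
  then show "cmod (\<Sum>y\<in>F. \<Sum>x\<in>F. (if x = y then 0 else H y x) * \<xi> x * cnj (\<eta> y)) \<le> 2 * C * fnorm F \<xi> * fnorm F \<eta>"
    using kboundD[OF k F] by simp
qed

section \<open>Coarse self-adjoint operators\<close>

locale coarse_flow =
  fixes Dh :: "'a::metric_space vec set" and h :: "'a op" and U :: "real \<Rightarrow> 'a op"
  assumes ulf: "unif_locally_finite TYPE('a)"
    and sa: "self_adjoint_unb Dh h"
    and coarse: "coarse_operator Dh h"
    and exp: "is_exp_ith Dh h U"
    and invariant: "\<And>t a. a \<in> uniform_roe \<Longrightarrow> U t \<circ> a \<circ> U (- t) \<in> uniform_roe"
begin

section \<open>The domain and the matrix of the coarse operator\<close>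

lemma Dh_l2: "\<xi> \<in> Dh \<Longrightarrow> \<xi> \<in> l2"
  using sa by (auto simp: self_adjoint_unb_def)

lemma h_l2: "\<xi> \<in> Dh \<Longrightarrow> h \<xi> \<in> l2"
  using sa by (simp add: self_adjoint_unb_def)

lemma Dh_lin: "\<xi> \<in> Dh \<Longrightarrow> \<eta> \<in> Dh \<Longrightarrow> (\<lambda>x. c * \<xi> x + \<eta> x) \<in> Dh"
  and h_lin: "\<xi> \<in> Dh \<Longrightarrow> \<eta> \<in> Dh \<Longrightarrow> h (\<lambda>x. c * \<xi> x + \<eta> x) = (\<lambda>x. c * h \<xi> x + h \<eta> x)"
  using sa by (simp_all add: self_adjoint_unb_def)

lemma Dh_dense: "\<xi> \<in> l2 \<Longrightarrow> 0 < e \<Longrightarrow> \<exists>\<eta>\<in>Dh. l2norm (vdiff \<xi> \<eta>) < e"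
  using sa by (simp add: self_adjoint_unb_def)

lemma h_symmetric: "\<xi> \<in> Dh \<Longrightarrow> \<eta> \<in> Dh \<Longrightarrow> l2inner (h \<xi>) \<eta> = l2inner \<xi> (h \<eta>)"
proof -
  assume \<xi>: "\<xi> \<in> Dh" and \<eta>: "\<eta> \<in> Dh"
  from sa have "\<forall>\<eta>\<in>l2. \<forall>\<zeta>\<in>l2. (\<forall>\<xi>\<in>Dh. l2inner (h \<xi>) \<eta> = l2inner \<xi> \<zeta>) \<longleftrightarrow> (\<eta> \<in> Dh \<and> h \<eta> = \<zeta>)"
    unfolding self_adjoint_unb_def by (elim conjE)
  from this[THEN bspec, OF Dh_l2[OF \<eta>], THEN bspec, OF h_l2[OF \<eta>]]
  have "(\<forall>\<xi>\<in>Dh. l2inner (h \<xi>) \<eta> = l2inner \<xi> (h \<eta>)) \<longleftrightarrow> (\<eta> \<in> Dh \<and> h \<eta> = h \<eta>)" .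
  with \<xi> \<eta> show ?thesis by simp
qed

lemma Dh_zero: "(\<lambda>x. 0) \<in> Dh" and h_zero: "h (\<lambda>x. 0) = (\<lambda>x. 0)"
proof -
  obtain \<eta> where "\<eta> \<in> Dh" using Dh_dense[OF l2_zero, of 1] by auto
  then show "(\<lambda>x. 0) \<in> Dh" "h (\<lambda>x. 0) = (\<lambda>x. 0)"
    using Dh_lin[of \<eta> \<eta> "-1"] h_lin[of \<eta> \<eta> "-1"] by simp_all
qed

lemma coarse_translation:
  assumes "partial_translation D f"
  shows "\<xi> \<in> Dh \<Longrightarrow> vop D f \<xi> \<in> Dh"
    and "\<exists>C. \<forall>\<xi>\<in>Dh. l2norm (vdiff (h (vop D f \<xi>)) (vop D f (h \<xi>))) \<le> C * l2norm \<xi>"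
  using coarse assms unfolding coarse_operator_def by (blast, blast)

text \<open>Density provides a domain vector whose coordinate at \<open>x\<close> is nonzero. The
  projection onto \<open>{x}\<close> comes from a partial translation, so it preserves the domain,
  and a scalar finishes. This gives the matrix of \<open>h\<close> its meaning.\<close>

lemma delta_Dh: "delta x \<in> Dh"
proof -
  obtain \<eta> where \<eta>: "\<eta> \<in> Dh" "l2norm (vdiff (delta x) \<eta>) < 1" using Dh_dense[of "delta x" 1] by auto
  have "cmod (vdiff (delta x) \<eta> x) < 1"
    using cmod_le_l2norm[OF l2_vdiff[OF delta_l2 Dh_l2[OF \<eta>(1)]]] \<eta>(2) by (meson order_le_less_trans)
  then have nz: "\<eta> x \<noteq> 0" by (auto simp: vdiff_def delta_def)
  have "restr {x} \<eta> \<in> Dh"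
    using coarse_translation(1)[OF partial_translation_id \<eta>(1), of "{x}"] by (simp add: vop_id)
  then have "(\<lambda>y. inverse (\<eta> x) * restr {x} \<eta> y + 0) \<in> Dh" by (rule Dh_lin[OF _ Dh_zero])
  moreover have "(\<lambda>y. inverse (\<eta> x) * restr {x} \<eta> y + 0) = delta x"
    using nz by (auto simp: restr_def delta_def)
  ultimately show ?thesis by simp
qed

lemma
  assumes "finite F"
  shows restr_Dh: "restr F \<xi> \<in> Dh" and h_restr: "h (restr F \<xi>) = (\<lambda>y. \<Sum>x\<in>F. \<xi> x * h (delta x) y)"
proof -
  have "(\<lambda>y. \<Sum>x\<in>F. \<xi> x * delta x y) \<in> Dh \<and>
      h (\<lambda>y. \<Sum>x\<in>F. \<xi> x * delta x y) = (\<lambda>y. \<Sum>x\<in>F. \<xi> x * h (delta x) y)"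
    using assms
  proof (induction F rule: finite_induct)
    case (insert x F)
    then show ?case
      using Dh_lin[OF delta_Dh, of _ "\<xi> x" x] h_lin[OF delta_Dh, of _ "\<xi> x" x] by simp
  qed (simp add: Dh_zero h_zero)
  then show "restr F \<xi> \<in> Dh" "h (restr F \<xi>) = (\<lambda>y. \<Sum>x\<in>F. \<xi> x * h (delta x) y)"
    by (simp_all add: restr_finite_sum assms)
qed

text \<open>Symmetry of \<open>h\<close> makes diagonal entries real, so the real part taken in
  \<open>diag_exp\<close> loses nothing.\<close>

lemma ker_h_diag: "ker h x x = of_real (diag_exp h x)"
proof -
  have "l2inner (h (delta x)) (delta x) = cnj (l2inner (h (delta x)) (delta x))"
    using h_symmetric[OF delta_Dh delta_Dh, of x x] l2inner_cnj[of "h (delta x)" "delta x"] by simp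
  then have "Im (h (delta x) x) = 0" by (simp add: complex_eq_iff)
  then show ?thesis by (simp add: ker_def diag_exp_def complex_eq_iff)
qed

text \<open>If a partial translation sends \<open>x\<close> to \<open>z\<close>, the difference of
  the two diagonal entries is the coordinate at \<open>z\<close> of its commutator with
  \<open>h\<close> applied to \<open>delta x\<close>. Finitely many translations serve all pairs
  within distance \<open>r\<close>, and the sum of their commutator bounds serves for all.\<close>

lemma coarse_map_diag_exp: "coarse_map (diag_exp h)"
  unfolding coarse_map_def
proof (intro allI impI)
  fix r :: real assume "0 < r"
  obtain I and D :: "nat \<times> nat \<Rightarrow> 'a set" and f where I: "finite I"
    and pt: "\<And>i. i \<in> I \<Longrightarrow> partial_translation (D i) (f i)"
    and ex1: "\<And>x y. dist x y \<le> r \<Longrightarrow> \<exists>!i. i \<in> I \<and> x \<in> D i \<and> y = f i x"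
    using translation_cover[OF ulf, of r] by metis
  have "\<exists>C. \<forall>\<xi>\<in>Dh. l2norm (vdiff (h (vop (D i) (f i) \<xi>)) (vop (D i) (f i) (h \<xi>))) \<le> C * l2norm \<xi>"
    if "i \<in> I" for i
    by (rule coarse_translation(2)[OF pt[OF that]])
  then obtain C where C: "\<And>i \<xi>. i \<in> I \<Longrightarrow> \<xi> \<in> Dh \<Longrightarrow>
      l2norm (vdiff (h (vop (D i) (f i) \<xi>)) (vop (D i) (f i) (h \<xi>))) \<le> C i * l2norm \<xi>"
    by metis
  have "\<bar>diag_exp h x - diag_exp h z\<bar> \<le> (\<Sum>i\<in>I. \<bar>C i\<bar>)" if xz: "dist x z \<le> r" for x z
  proof -
    obtain i where i: "i \<in> I" "x \<in> D i" "z = f i x" using ex1[OF xz] by blast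
    have inj: "inj_on (f i) (D i)" using pt[OF i(1)] by (simp add: partial_translation_def)
    have v: "vop (D i) (f i) (delta x) = delta z"
      by (rule ext) (simp add: vop_delta[OF inj] i(2), simp add: delta_def i(3))
    have vz: "vop (D i) (f i) \<xi> z = \<xi> x" for \<xi>
      using i by (simp add: vop_def the_inv_into_f_f[OF inj])
    have l2: "vop (D i) (f i) (h (delta x)) \<in> l2"
      by (intro bounded_op_l2[OF bounded_op_vop[OF inj]] h_l2 delta_Dh)
    have "complex_of_real (diag_exp h z - diag_exp h x) = vdiff (h (delta z)) (vop (D i) (f i) (h (delta x))) z"
      using ker_h_diag[of z] ker_h_diag[of x] by (simp add: vdiff_def vz ker_def)
    then have "\<bar>diag_exp h z - diag_exp h x\<bar> \<le> l2norm (vdiff (h (delta z)) (vop (D i) (f i) (h (delta x))))"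
      using cmod_le_l2norm[OF l2_vdiff[OF h_l2[OF delta_Dh] l2]] by (metis norm_of_real)
    also have "\<dots> \<le> C i" using C[OF i(1) delta_Dh, of x] by (simp add: v)
    also have "\<dots> \<le> (\<Sum>i\<in>I. \<bar>C i\<bar>)" using member_le_sum[of i I "\<lambda>i. \<bar>C i\<bar>"] i(1) I by simp
    finally show ?thesis by (simp add: abs_minus_commute)
  qed
  then show "\<exists>s. \<forall>x z. dist x z \<le> r \<longrightarrow> \<bar>diag_exp h x - diag_exp h z\<bar> \<le> s" by blast
qed

text \<open>The bound depends on \<open>A\<close>. Rounding it up to a natural number makes the
  power set a countable union, as the category argument requires.\<close>

lemma kbound_commutator:
  "\<exists>n::nat. kbound (\<lambda>y x. ker h y x * (indicator A x - indicator A y)) (real n)"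
proof -
  obtain C where C: "\<And>\<xi>. \<xi> \<in> Dh \<Longrightarrow> l2norm (vdiff (h (restr A \<xi>)) (restr A (h \<xi>))) \<le> C * l2norm \<xi>"
    using coarse_translation(2)[OF partial_translation_id, of A] unfolding vop_id by blast
  obtain n :: nat where n: "C \<le> real n" using real_arch_simple by blast
  have "kbound (\<lambda>y x. ker h y x * (indicator A x - indicator A y)) C"
    unfolding kbound_def
  proof (intro allI impI)
    fix F :: "'a set" and \<xi> \<eta> :: "'a vec" assume F: "finite F"
    define v where "v = vdiff (h (restr A (restr F \<xi>))) (restr A (h (restr F \<xi>)))"
    have rr: "restr A (restr F \<xi>) = restr F (restr A \<xi>)" by (auto simp: restr_def)
    have ri: "restr S \<zeta> y = indicator S y * \<zeta> y" for S and \<zeta> :: "'a vec" and y by (simp add: restr_def)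
    have v: "v y = (\<Sum>x\<in>F. ker h y x * (indicator A x - indicator A y) * \<xi> x)" for y
      unfolding v_def rr h_restr[OF F] vdiff_def ri
      by (simp add: ker_def sum_distrib_left sum_subtractf algebra_simps)
    have v2: "v \<in> l2"
      unfolding v_def rr by (intro l2_vdiff restr_l2 h_l2 restr_Dh F)
    have "(\<Sum>y\<in>F. \<Sum>x\<in>F. ker h y x * (indicator A x - indicator A y) * \<xi> x * cnj (\<eta> y)) =
        l2inner v (restr F \<eta>)"
      by (subst l2inner_finite_right[OF F]) (auto simp: restr_def v sum_distrib_right)
    also have "cmod \<dots> \<le> l2norm v * l2norm (restr F \<eta>)" by (intro l2inner_bound v2 restr_finite_l2 F)
    also have "\<dots> \<le> C * l2norm (restr F \<xi>) * l2norm (restr F \<eta>)"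
      unfolding v_def by (intro mult_right_mono C restr_Dh F) simp
    finally show "cmod (\<Sum>y\<in>F. \<Sum>x\<in>F. ker h y x * (indicator A x - indicator A y) * \<xi> x * cnj (\<eta> y))
        \<le> C * fnorm F \<xi> * fnorm F \<eta>"
      by (simp add: l2norm_restr_finite F)
  qed
  with n show ?thesis using kbound_mono by blast
qed

text \<open>The closedness condition is immediate here: a single instance of \<open>kbound\<close>
  sees the indicator on a finite \<open>F\<close> only, where \<open>A\<close> and \<open>A'\<close>
  agree. The commutator is linear in the indicator, so the three terms cost a factor 3.\<close>

lemma h_off_diagonal_bounded: "\<exists>C. kbound (\<lambda>y x. if x = y then 0 else ker h y x) C"
proof -
  define P where "P n A = kbound (\<lambda>y x. ker h y x * (indicator A x - indicator A y)) (real n)" for n A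
  have "\<exists>n. \<forall>A. \<exists>A1 A2 A3. P n A1 \<and> P n A2 \<and> P n A3 \<and>
    (\<forall>x. indicator A x = indicator A1 x - indicator A2 x + (indicator A3 x :: complex))"
  proof (rule uniform_over_subsets[of P])
    fix n A assume ex: "\<And>F. finite F \<Longrightarrow> \<exists>A'. A' \<inter> F = A \<inter> F \<and> P n A'"
    show "P n A"
      unfolding P_def kbound_def
    proof (intro allI impI)
      fix F :: "'a set" and \<xi> \<eta> :: "'a vec" assume F: "finite F"
      obtain A' where A': "A' \<inter> F = A \<inter> F" "P n A'" using ex[OF F] by blast
      have i: "indicator A x = (indicator A' x :: complex)" if "x \<in> F" for x
        using A'(1) that by (auto simp: indicator_def)
      have "(\<Sum>y\<in>F. \<Sum>x\<in>F. ker h y x * (indicator A x - indicator A y) * \<xi> x * cnj (\<eta> y)) =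
          (\<Sum>y\<in>F. \<Sum>x\<in>F. ker h y x * (indicator A' x - indicator A' y) * \<xi> x * cnj (\<eta> y))"
        by (intro sum.cong refl) (simp only: i)
      then show "cmod (\<Sum>y\<in>F. \<Sum>x\<in>F. ker h y x * (indicator A x - indicator A y) * \<xi> x * cnj (\<eta> y))
          \<le> real n * fnorm F \<xi> * fnorm F \<eta>"
        using kboundD[OF A'(2)[unfolded P_def] F] by simp
    qed
  next
    show "\<exists>n. P n A" for A unfolding P_def by (rule kbound_commutator)
    show "P m A" if "P n A" "n \<le> m" for n m A
      using kbound_mono[OF that(1)[unfolded P_def], of "real m"] that(2) by (simp add: P_def)
  qed
  then obtain n where n: "\<And>A. \<exists>A1 A2 A3. P n A1 \<and> P n A2 \<and> P n A3 \<and>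
    (\<forall>x. indicator A x = indicator A1 x - indicator A2 x + (indicator A3 x :: complex))"
    by blast
  have "kbound (\<lambda>y x. ker h y x * (indicator A x - indicator A y)) (3 * real n)" for A
  proof -
    obtain A1 A2 A3 where A: "P n A1" "P n A2" "P n A3"
      "\<And>x. indicator A x = indicator A1 x - indicator A2 x + (indicator A3 x :: complex)"
      using n[of A] by blast
    have "kbound (\<lambda>y x. -1 * (ker h y x * (indicator A2 x - indicator A2 y)) +
        (1 * (ker h y x * (indicator A1 x - indicator A1 y)) + ker h y x * (indicator A3 x - indicator A3 y)))
        (cmod (-1) * real n + (cmod 1 * real n + real n))"
      using A(1-3) unfolding P_def by (intro kbound_lin)
    then show ?thesis unfolding A(4) by (simp add: algebra_simps)
  qed
  from kbound_off_diagonal[OF this] show ?thesis ..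
qed

section \<open>The unitary group\<close>

lemma U_bounded: "bounded_op (U t)"
  using exp by (simp add: is_exp_ith_def unitary_op_def)

lemmas U_l2 = bounded_op_l2[OF U_bounded]

lemma U_zero: "\<xi> \<in> l2 \<Longrightarrow> U 0 \<xi> = \<xi>"
  using exp by (simp add: is_exp_ith_def op_eq_def)

lemma U_add: "\<xi> \<in> l2 \<Longrightarrow> U (s + t) \<xi> = U s (U t \<xi>)"
  using exp by (simp add: is_exp_ith_def op_eq_def)

lemma U_inverse: "\<xi> \<in> l2 \<Longrightarrow> U t (U (- t) \<xi>) = \<xi>"
  using U_add[of \<xi> t "-t"] U_zero by simp

lemma U_adjoint: "is_adjoint (U t) (U (- t))"
proof -
  have "unitary_op (U t)" using exp by (simp add: is_exp_ith_def)
  then obtain S where S: "bounded_op S" "is_adjoint (U t) S" "op_eq (U t \<circ> S) id"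
    unfolding unitary_op_def by blast
  have "S \<xi> = U (- t) \<xi>" if \<xi>: "\<xi> \<in> l2" for \<xi>
  proof -
    have l: "S \<xi> \<in> l2" by (rule bounded_op_l2[OF S(1) \<xi>])
    have "U (- t) (U t (S \<xi>)) = S \<xi>" using U_inverse[OF l, of "-t"] by simp
    moreover have "U t (S \<xi>) = \<xi>" using S(3) \<xi> by (simp add: op_eq_def)
    ultimately show ?thesis by simp
  qed
  with S(2) show ?thesis by (simp add: is_adjoint_def)
qed

lemma U_inner: "\<xi> \<in> l2 \<Longrightarrow> \<eta> \<in> l2 \<Longrightarrow> l2inner (U t \<xi>) \<eta> = l2inner \<xi> (U (- t) \<eta>)"
  using U_adjoint by (simp add: is_adjoint_def)

lemma U_norm: "\<xi> \<in> l2 \<Longrightarrow> l2norm (U t \<xi>) = l2norm \<xi>"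
proof -
  assume \<xi>: "\<xi> \<in> l2"
  have "U (- t) (U t \<xi>) = \<xi>" using U_inverse[OF \<xi>, of "-t"] by simp
  then have "complex_of_real ((l2norm (U t \<xi>))\<^sup>2) = complex_of_real ((l2norm \<xi>)\<^sup>2)"
    unfolding l2inner_self[OF U_l2[OF \<xi>], symmetric] l2inner_self[OF \<xi>, symmetric]
    by (simp add: U_inner[OF \<xi> U_l2[OF \<xi>]])
  then have "(l2norm (U t \<xi>))\<^sup>2 = (l2norm \<xi>)\<^sup>2" by (simp only: of_real_eq_iff)
  then show ?thesis by (simp add: power2_eq_iff_nonneg)
qed

text \<open>The generator is given through norm limits at time 0. Moving \<open>U t\<close> to the
  other argument of the inner product transports the limit to any time, for matrix
  coefficients.\<close>

lemma U_derivative: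
  assumes \<xi>: "\<xi> \<in> Dh" and \<eta>: "\<eta> \<in> l2"
  shows "((\<lambda>t. l2inner (U t \<xi>) \<eta>) has_vector_derivative \<i> * l2inner (U t (h \<xi>)) \<eta>) (at t)"
proof -
  define \<eta>' where "\<eta>' = U (- t) \<eta>"
  have \<eta>': "\<eta>' \<in> l2" by (simp add: \<eta>'_def U_l2 \<eta>)
  have \<xi>2: "\<xi> \<in> l2" and h\<xi>: "h \<xi> \<in> l2" using \<xi> by (auto intro: Dh_l2 h_l2)
  have split: "l2inner (U (t + s) \<xi>) \<eta> = l2inner (U s \<xi>) \<eta>'" for s
    by (simp add: U_add \<xi>2 U_inner[OF U_l2[OF \<xi>2] \<eta>] \<eta>'_def)
  define q where "q s = (\<lambda>x. (U s \<xi> x - \<xi> x) / of_real s - \<i> * h \<xi> x)" for s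
  have q0: "((\<lambda>s. l2norm (q s)) \<longlongrightarrow> 0) (at 0)"
    using exp \<xi> by (simp add: is_exp_ith_def q_def)
  have q: "q s = (\<lambda>x. inverse (of_real s) * vdiff (U s \<xi>) \<xi> x + (- \<i>) * h \<xi> x)" for s
    by (simp add: q_def vdiff_def divide_inverse mult.commute)
  have q2: "q s \<in> l2" for s
    unfolding q by (intro l2_lin l2_vdiff l2_scale U_l2 \<xi>2 h\<xi>)
  have qi: "l2inner (q s) \<eta>' = inverse (of_real s) * (l2inner (U s \<xi>) \<eta>' - l2inner \<xi> \<eta>') - \<i> * l2inner (h \<xi>) \<eta>'" for s
    unfolding q l2inner_lin_left[OF l2_vdiff[OF U_l2[OF \<xi>2] \<xi>2] l2_scale[OF h\<xi>] \<eta>']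
      l2inner_vdiff_left[OF U_l2[OF \<xi>2] \<xi>2 \<eta>']
    using l2inner_lin_left[OF h\<xi> l2_zero \<eta>', of "-\<i>"] by simp
  have "((\<lambda>s. l2norm (q s) * l2norm \<eta>') \<longlongrightarrow> 0) (at 0)"
    using tendsto_mult_right[OF q0, of "l2norm \<eta>'"] by simp
  then have "((\<lambda>s. norm (l2inner (U (t + s) \<xi>) \<eta> - l2inner (U t \<xi>) \<eta> - s *\<^sub>R (\<i> * l2inner (U t (h \<xi>)) \<eta>)) / norm s)
      \<longlongrightarrow> 0) (at 0)"
  proof (rule Lim_null_comparison[rotated])
    have "norm (norm (l2inner (U (t + s) \<xi>) \<eta> - l2inner (U t \<xi>) \<eta> - s *\<^sub>R (\<i> * l2inner (U t (h \<xi>)) \<eta>)) / norm s)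
        \<le> l2norm (q s) * l2norm \<eta>'" if s: "s \<noteq> 0" for s
    proof -
      have "l2inner (U (t + s) \<xi>) \<eta> - l2inner (U t \<xi>) \<eta> - s *\<^sub>R (\<i> * l2inner (U t (h \<xi>)) \<eta>)
          = of_real s * l2inner (q s) \<eta>'"
        unfolding qi split[of s] using split[of 0] s
        by (simp add: U_zero \<xi>2 U_inner[OF h\<xi> \<eta>] \<eta>'_def scaleR_conv_of_real field_simps)
      then show ?thesis using s l2inner_bound[OF q2 \<eta>', of s] by (simp add: norm_mult)
    qed
    then show "\<forall>\<^sub>F s in at 0. norm (norm (l2inner (U (t + s) \<xi>) \<eta> - l2inner (U t \<xi>) \<eta> - s *\<^sub>R (\<i> * l2inner (U t (h \<xi>)) \<eta>)) / norm s)
        \<le> l2norm (q s) * l2norm \<eta>'"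
      by (intro eventually_at_filter[THEN iffD2] always_eventually) auto
  qed
  then show ?thesis
    unfolding has_vector_derivative_def has_derivative_at by (simp add: bounded_linear_scaleR_left)
qed

section \<open>The diagonal unitary group and its distance from exp(i t h)\<close>

definition phase :: "real \<Rightarrow> 'a \<Rightarrow> complex" where
  "phase t x = exp (- \<i> * of_real (t * diag_exp h x))"

lemma phase_norm [simp]: "cmod (phase t x) = 1"
proof -
  have "phase t x = cis (- (t * diag_exp h x))" by (simp add: phase_def cis_conv_exp)
  then show ?thesis by simp
qed

lemma phase_add: "phase (s + t) x = phase s x * phase t x"
  by (simp add: phase_def exp_add[symmetric] algebra_simps)

lemma phase_zero [simp]: "phase 0 x = 1"
  by (simp add: phase_def)

lemma phase_inverse [simp]: "phase t x * phase (- t) x = 1" "phase (- t) x * phase t x = 1"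
  using phase_add[of t "-t" x] phase_add[of "-t" t x] by simp_all

lemma cnj_phase: "cnj (phase t x) = phase (- t) x"
  by (simp add: phase_def exp_cnj)

lemma phase_derivative:
  "((\<lambda>t. phase t x) has_vector_derivative - \<i> * of_real (diag_exp h x) * phase t x) (at t)"
proof -
  have "((\<lambda>z. exp (- \<i> * of_real (diag_exp h x) * z)) has_field_derivative
      - \<i> * of_real (diag_exp h x) * exp (- \<i> * of_real (diag_exp h x) * of_real t)) (at (of_real t))"
    by (auto intro!: derivative_eq_intros)
  from has_vector_derivative_real_field[OF this] show ?thesis by (simp add: phase_def mult_ac)
qed

definition W :: "real \<Rightarrow> 'a op" where
  "W t = U t \<circ> mult_op (phase t)"

lemma mult_phase_l2: "\<xi> \<in> l2 \<Longrightarrow> mult_op (phase t) \<xi> \<in> l2"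
  by (rule mult_op_l2[of _ 1]) simp_all

lemma W_bounded: "bounded_op (W t)"
  unfolding W_def by (intro bounded_op_comp U_bounded bounded_op_mult_op[of _ 1]) simp

lemma mult_op_delta: "mult_op m (delta x) = (\<lambda>y. m x * delta x y)"
  by (auto simp: mult_op_def delta_def)

lemma W_delta: "W t (delta x) = (\<lambda>y. phase t x * U t (delta x) y)"
  by (simp add: W_def mult_op_delta bounded_op_scale[OF U_bounded])

text \<open>Duhamel's formula in weak form. Differentiation is confined to scalar coefficients with
  finitely supported \<open>\<xi>\<close>, which lies in the domain of \<open>h\<close>. The
  derivative of the phase cancels the diagonal of \<open>h\<close>, so the speed is bounded by the
  off-diagonal bound \<open>C\<close>.\<close>

lemma W_near_id: "\<exists>C\<ge>0. \<forall>t. \<forall>\<xi>\<in>l2. l2norm (vdiff (W t \<xi>) \<xi>) \<le> C * \<bar>t\<bar> * l2norm \<xi>"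
proof -
  define off where "off y x = (if x = y then 0 else ker h y x)" for y x
  obtain C where C: "kbound off C" using h_off_diagonal_bounded unfolding off_def by blast
  have C0: "0 \<le> C" by (rule kbound_nonneg[OF C])
  have offl2: "(\<lambda>y. off y x) \<in> l2" for x
  proof -
    have "(\<lambda>y. off y x) = vdiff (h (delta x)) (\<lambda>y. of_real (diag_exp h x) * delta x y)"
      using ker_h_diag[of x] by (auto simp: off_def vdiff_def delta_def ker_def)
    then show ?thesis by (simp add: l2_vdiff l2_scale h_l2 delta_Dh)
  qed
  have "kbound (ker (\<lambda>\<xi>. vdiff (W t \<xi>) \<xi>)) (C * \<bar>t\<bar>)" for t
    unfolding kbound_def
  proof (intro allI impI)
    fix F :: "'a set" and \<xi> \<eta> :: "'a vec" assume F: "finite F"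
    define \<zeta> where "\<zeta> = restr F \<eta>"
    have \<zeta>: "\<zeta> \<in> l2" "l2norm \<zeta> = fnorm F \<eta>" by (simp_all add: \<zeta>_def restr_finite_l2 l2norm_restr_finite F)
    \<comment> \<open>The coefficient of \<open>W s\<close> between \<open>restr F \<xi>\<close> and
      \<open>\<zeta>\<close>, expanded over \<open>F\<close> so that the product rule applies
      termwise.\<close>
    define psi where "psi s = (\<Sum>x\<in>F. \<xi> x * (phase s x * l2inner (U s (delta x)) \<zeta>))" for s
    \<comment> \<open>The off-diagonal part of \<open>h\<close> applied to the vector rotated by the
      phases; rotation does not change \<open>fnorm\<close>, so \<open>kbound_column\<close> bounds
      it.\<close>
    define v where "v s = (\<lambda>y. \<Sum>x\<in>F. off y x * (phase s x * \<xi> x))" for s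
    have der: "(psi has_vector_derivative \<i> * l2inner (v s) (U (- s) \<zeta>)) (at s)" for s
    proof -
      have "(psi has_vector_derivative (\<Sum>x\<in>F. \<xi> x * (phase s x * (\<i> * l2inner (U s (h (delta x))) \<zeta>)
          + - \<i> * of_real (diag_exp h x) * phase s x * l2inner (U s (delta x)) \<zeta>))) (at s)"
        unfolding psi_def
        by (intro has_vector_derivative_sum has_vector_derivative_mult_right has_vector_derivative_mult
            phase_derivative U_derivative delta_Dh \<zeta>)
      moreover have "phase s x * (\<i> * l2inner (U s (h (delta x))) \<zeta>)
          + - \<i> * of_real (diag_exp h x) * phase s x * l2inner (U s (delta x)) \<zeta>
          = \<i> * (phase s x * l2inner (\<lambda>y. off y x) (U (- s) \<zeta>))" for x
      proof -
        have "(\<lambda>y. off y x) = (\<lambda>y. - of_real (diag_exp h x) * delta x y + h (delta x) y)"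
          using ker_h_diag[of x] by (auto simp: off_def delta_def ker_def)
        then have "l2inner (\<lambda>y. off y x) (U (- s) \<zeta>) = - of_real (diag_exp h x) * l2inner (delta x) (U (- s) \<zeta>)
            + l2inner (h (delta x)) (U (- s) \<zeta>)"
          by (simp only: l2inner_lin_left delta_l2 h_l2 delta_Dh U_l2 \<zeta>)
        then show ?thesis
          by (simp only: U_inner[OF delta_l2 \<zeta>(1)] U_inner[OF h_l2[OF delta_Dh] \<zeta>(1)]) (simp add: algebra_simps)
      qed
      moreover have "(\<Sum>x\<in>F. \<xi> x * (\<i> * (phase s x * l2inner (\<lambda>y. off y x) (U (- s) \<zeta>)))) = \<i> * l2inner (v s) (U (- s) \<zeta>)"
        using l2inner_sum_left[of F "\<lambda>x y. off y x" "U (- s) \<zeta>" "\<lambda>x. phase s x * \<xi> x", OF offl2 U_l2[OF \<zeta>(1)]]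
        by (simp add: v_def sum_distrib_left mult_ac)
      ultimately show ?thesis by (simp only:)
    qed
    have bound: "norm (\<i> * l2inner (v s) (U (- s) \<zeta>)) \<le> C * fnorm F \<xi> * fnorm F \<eta>" for s
    proof -
      have "fnorm G (v s) \<le> C * fnorm F \<xi>" if "finite G" for G
        using kbound_column[OF C F that, of "\<lambda>x. phase s x * \<xi> x"] by (simp add: v_def norm_mult)
      then have "v s \<in> l2" "l2norm (v s) \<le> C * fnorm F \<xi>" by (auto intro: l2I l2norm_leI)
      then have "cmod (l2inner (v s) (U (- s) \<zeta>)) \<le> C * fnorm F \<xi> * l2norm (U (- s) \<zeta>)"
        using l2inner_bound[OF _ U_l2[OF \<zeta>(1)], of "v s" "- s"]
        by (meson l2norm_nonneg mult_right_mono order_trans)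
      then show ?thesis by (simp add: U_norm \<zeta> norm_mult)
    qed
    have "norm (psi t - psi 0) \<le> C * fnorm F \<xi> * fnorm F \<eta> * norm (t - 0)"
    proof (rule differentiable_bound[of UNIV])
      show "(psi has_derivative (\<lambda>u. u *\<^sub>R (\<i> * l2inner (v s) (U (- s) \<zeta>)))) (at s within UNIV)" for s
        using der[of s] by (simp add: has_vector_derivative_def)
      show "onorm (\<lambda>u. u *\<^sub>R (\<i> * l2inner (v s) (U (- s) \<zeta>))) \<le> C * fnorm F \<xi> * fnorm F \<eta>" for s
        using bound[of s] C0 by (intro onorm_bound) (simp_all add: mult_left_mono mult.commute[of _ "\<bar>_\<bar>"])
    qed auto
    moreover have "psi s = (\<Sum>y\<in>F. \<Sum>x\<in>F. ker (W s) y x * \<xi> x * cnj (\<eta> y))" for s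
    proof -
      have "psi s = (\<Sum>x\<in>F. \<xi> x * l2inner (W s (delta x)) \<zeta>)"
        unfolding psi_def W_delta using l2inner_lin_left[OF U_l2[OF delta_l2] l2_zero \<zeta>(1)] by simp
      also have "\<dots> = l2inner (W s (restr F \<xi>)) \<zeta>"
        unfolding bounded_op_restr_finite[OF W_bounded F]
        by (rule l2inner_sum_left[symmetric]) (auto intro: bounded_op_l2[OF W_bounded] \<zeta>)
      also have "\<dots> = (\<Sum>y\<in>F. \<Sum>x\<in>F. ker (W s) y x * \<xi> x * cnj (\<eta> y))"
        unfolding \<zeta>_def by (rule ker_form[OF W_bounded F])
      finally show ?thesis .
    qed
    moreover have "ker (W 0) y x = delta x y" for x y
      by (simp add: ker_def W_delta U_zero)
    ultimately have "(\<Sum>y\<in>F. \<Sum>x\<in>F. ker (\<lambda>\<xi>. vdiff (W t \<xi>) \<xi>) y x * \<xi> x * cnj (\<eta> y)) = psi t - psi 0"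
      and "cmod (psi t - psi 0) \<le> C * fnorm F \<xi> * fnorm F \<eta> * \<bar>t\<bar>"
      by (simp_all add: ker_def vdiff_def left_diff_distrib sum_subtractf)
    then show "cmod (\<Sum>y\<in>F. \<Sum>x\<in>F. ker (\<lambda>\<xi>. vdiff (W t \<xi>) \<xi>) y x * \<xi> x * cnj (\<eta> y))
        \<le> C * \<bar>t\<bar> * fnorm F \<xi> * fnorm F \<eta>"
      by (simp add: mult_ac)
  qed
  then have "\<forall>\<xi>\<in>l2. l2norm (vdiff (W t \<xi>) \<xi>) \<le> C * \<bar>t\<bar> * l2norm \<xi>" for t
    using C0 bounded_op_vdiff[OF W_bounded bounded_op_id]
    by (intro ballI l2norm_le_kbound[of "\<lambda>\<xi>. vdiff (W t \<xi>) \<xi>"]) auto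
  with C0 show ?thesis by blast
qed

section \<open>Membership in the uniform Roe algebra\<close>

text \<open>The matrix of the conjugated projection, written as an inner product so that its
  continuity in \<open>A\<close> can be read off from \<open>restr_inner_continuous\<close>.\<close>

definition cker :: "real \<Rightarrow> 'a set \<Rightarrow> 'a \<Rightarrow> 'a \<Rightarrow> complex" where
  "cker t A y x = l2inner (restr A (U (- t) (delta x))) (U (- t) (delta y))"

lemma cker_ker: "cker t A = ker (U t \<circ> restr A \<circ> U (- t))"
proof (intro ext)
  fix y x
  have "l2inner (U t (restr A (U (- t) (delta x)))) (delta y) = cker t A y x"
    unfolding cker_def by (intro U_inner restr_l2 U_l2 delta_l2)
  then show "cker t A y x = ker (U t \<circ> restr A \<circ> U (- t)) y x" by (simp add: ker_def)
qed

text \<open>Here the invariance of the algebra enters, through projections. The propagation found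
  still depends on \<open>A\<close>.\<close>

lemma cker_appr: "0 < e \<Longrightarrow> \<exists>n::nat. appr (cker t A) (real n) e"
proof -
  assume e: "0 < e"
  have "band_dominated (U t \<circ> restr A \<circ> U (- t))"
    by (intro band_dominated_uniform_roe invariant restr_roe)
  then obtain r where r: "appr (cker t A) r e" using band_dominated_appr[OF _ e] cker_ker by metis
  obtain n :: nat where "r \<le> real n" using real_arch_simple by blast
  with r show ?thesis using appr_mono by blast
qed

lemma cker_bound: "cmod (cker t A y x) \<le> 1"
proof -
  have d: "U (- t) (delta z) \<in> l2" "l2norm (U (- t) (delta z)) = 1" for z by (simp_all add: U_l2 U_norm)
  have "cmod (cker t A y x) \<le> l2norm (restr A (U (- t) (delta x))) * l2norm (U (- t) (delta y))"
    unfolding cker_def by (intro l2inner_bound restr_l2 d)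
  also have "\<dots> \<le> 1" using l2norm_restr[OF d(1), of A x] by (simp add: d)
  finally show ?thesis .
qed

lemma cker_uniform_appr:
  assumes e: "0 < e"
  shows "\<exists>n::nat. \<forall>A. appr (cker t A) (real n) e"
proof -
  \<comment> \<open>A third of e, since a general subset is reached by a combination of three good
    ones.\<close>
  define P where "P n A = appr (cker t A) (real n) (e / 3)" for n A
  have "\<exists>n. \<forall>A. \<exists>A1 A2 A3. P n A1 \<and> P n A2 \<and> P n A3 \<and>
    (\<forall>x. indicator A x = indicator A1 x - indicator A2 x + (indicator A3 x :: complex))"
  proof (rule uniform_over_subsets[of P])
    fix n A assume "\<And>F. finite F \<Longrightarrow> \<exists>A'. A' \<inter> F = A \<inter> F \<and> P n A'"
    \<comment> \<open>The net has to be defined for every \<open>F\<close>; at infinite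
      \<open>F\<close> any set with \<open>P n\<close> will do.\<close>
    then have "\<exists>A'. P n A' \<and> (finite F \<longrightarrow> A' \<inter> F = A \<inter> F)" for F
      by (cases "finite F") (blast, metis finite.emptyI)
    then obtain A' where A': "\<And>F. P n (A' F)" "\<And>F. finite F \<Longrightarrow> A' F \<inter> F = A \<inter> F" by metis
    show "P n A"
      unfolding P_def
    proof (rule appr_limit[OF finite_subsets_at_top_neq_bot])
      show "appr (cker t (A' F)) (real n) (e / 3)" for F using A'(1) by (simp add: P_def)
      show "cmod (cker t (A' F) y x) \<le> 1" for F x y by (rule cker_bound)
      show "((\<lambda>F. cker t (A' F) y x) \<longlongrightarrow> cker t A y x) (finite_subsets_at_top UNIV)" for x y
        unfolding cker_def by (intro restr_inner_continuous U_l2 delta_l2 A'(2))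
    qed
  next
    show "\<exists>n. P n A" for A unfolding P_def using e by (intro cker_appr) simp
    show "P m A" if "P n A" "n \<le> m" for n m A
      using appr_mono[OF that(1)[unfolded P_def], of "real m" "e / 3"] that(2) by (simp add: P_def)
  qed
  then obtain n where n: "\<And>A. \<exists>A1 A2 A3. P n A1 \<and> P n A2 \<and> P n A3 \<and>
    (\<forall>x. indicator A x = indicator A1 x - indicator A2 x + (indicator A3 x :: complex))"
    by blast
  have "appr (cker t A) (real n) e" for A
  proof -
    obtain A1 A2 A3 where A: "P n A1" "P n A2" "P n A3"
      "\<And>x. indicator A x = indicator A1 x - indicator A2 x + (indicator A3 x :: complex)"
      using n[of A] by blast
    have "appr (\<lambda>y x. -1 * cker t A2 y x + (1 * cker t A1 y x + cker t A3 y x))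
        (real n) (cmod (-1) * (e / 3) + (cmod 1 * (e / 3) + e / 3))"
      using A(1-3) unfolding P_def by (intro appr_lin)
    moreover have "(\<lambda>y x. -1 * cker t A2 y x + (1 * cker t A1 y x + cker t A3 y x)) = cker t A"
    proof (intro ext)
      fix y x
      define v where "v = U (- t) (delta x)"
      have v: "v \<in> l2" by (simp add: v_def U_l2)
      have ri: "restr S v y = indicator S y * v y" for S y by (simp add: restr_def)
      have "restr A v = (\<lambda>y. -1 * restr A2 v y + (\<lambda>y. 1 * restr A1 v y + restr A3 v y) y)"
        by (rule ext) (simp add: ri A(4) algebra_simps)
      then show "-1 * cker t A2 y x + (1 * cker t A1 y x + cker t A3 y x) = cker t A y x"
        unfolding cker_def v_def[symmetric]
        by (simp only: l2inner_lin_left l2_lin restr_l2 v U_l2 delta_l2)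
    qed
    ultimately show ?thesis by simp
  qed
  then show ?thesis by blast
qed

definition U_diag :: "real \<Rightarrow> 'a \<Rightarrow> complex" where
  "U_diag t x = U (- t) (delta x) x"

lemma U_diag_le: "cmod (U_diag t x) \<le> 1"
  using cmod_le_l2norm[OF U_l2[OF delta_l2], of "- t" x x] by (simp add: U_diag_def U_norm)

text \<open>Averaging the operators U a (U inverse) a over all diagonal sign operators a yields U times the
  diagonal part of U inverse.\<close>

lemma U_diag_appr:
  assumes e: "0 < e"
  shows "\<exists>r. appr (\<lambda>y x. ker (U t) y x * U_diag t x) r e"
proof -
  obtain n :: nat where n: "\<And>A. appr (cker t A) (real n) (e / 2)"
    using cker_uniform_appr[of "e / 2" t] e by auto
  \<comment> \<open>The matrix of U s (U inverse) s with s = 1 - 2 p: the identity contributes no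
    error, and the factor -2 turns e / 2 into e.\<close>
  define z where "z A y x = (-2 * cker t A y x + (if x = y then 1 else 0)) * sgn_on A x" for A y x
  have "appr (\<lambda>y x. if x = y then 1 else 0) (real n) 0"
    unfolding appr_def by (intro exI[of _ "\<lambda>y x. if x = y then 1 else 0"]) (simp add: kbound_def)
  then have z_appr: "appr (z A) (real n) e" for A
    unfolding z_def using appr_lin[OF n, of "\<lambda>y x. if x = y then 1 else 0" 0 "-2" A]
    by (intro appr_diag) (auto simp: sgn_on_def)
  define u where "u x = U (- t) (delta x)" for x
  have u: "u x \<in> l2" for x by (simp add: u_def U_l2)
  have uu: "l2inner (u x) (u y) = (if x = y then 1 else 0)" for x y
    using U_inner[OF delta_l2 u, of "-t" x y] U_inverse[OF delta_l2, of t y] by (auto simp: u_def delta_apply)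
  have s2: "mult_op (sgn_on A) \<xi> \<in> l2" if "\<xi> \<in> l2" for A \<xi>
    using that by (intro mult_op_l2[of _ 1]) (auto simp: sgn_on_def)
  have z: "z A y x = sgn_on A x * l2inner (mult_op (sgn_on A) (u x)) (u y)" for A y x
  proof -
    have "mult_op (sgn_on A) (u x) = (\<lambda>y. -2 * restr A (u x) y + u x y)"
      by (auto simp: mult_op_def sgn_on_def restr_def)
    then have "l2inner (mult_op (sgn_on A) (u x)) (u y) = -2 * l2inner (restr A (u x)) (u y) + l2inner (u x) (u y)"
      by (simp only: l2inner_lin_left restr_l2 u)
    then show ?thesis by (simp add: z_def uu[unfolded u_def] cker_def u_def)
  qed
  have z_le: "cmod (z A y x) \<le> 1" for A y x
  proof -
    have "cmod (z A y x) \<le> l2norm (mult_op (sgn_on A) (u x)) * l2norm (u y)"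
      unfolding z using l2inner_bound[OF s2[OF u] u] by (simp add: norm_mult sgn_on_def)
    also have "\<dots> \<le> 1"
      using l2norm_mult_op[of "sgn_on A" 1, OF _ u[of x]] by (simp add: u_def U_norm sgn_on_def)
    finally show ?thesis .
  qed
  define Z where "Z F y x = (\<Sum>A\<in>Pow F. 1 / 2 ^ card F * z A y x)" for F y x
  \<comment> \<open>The weights sum to 1 for finite \<open>F\<close>; for infinite \<open>F\<close>
    the sum over the infinite power set is 0 by convention.\<close>
  have tot: "(\<Sum>A\<in>Pow F. cmod (1 / 2 ^ card F)) \<le> 1" for F :: "'a set"
    by (cases "finite F") (simp_all add: card_Pow norm_divide norm_power)
  have "appr (\<lambda>y x. ker (U t) y x * U_diag t x) (real n) e"
  proof (rule appr_limit[OF finite_subsets_at_top_neq_bot])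
    show "appr (Z F) (real n) e" for F
    proof -
      have "appr (Z F) (real n) (\<Sum>A\<in>Pow F. cmod (1 / 2 ^ card F) * e)"
        unfolding Z_def by (intro appr_sum z_appr)
      then show ?thesis
        by (rule appr_mono) (use e mult_right_mono[OF tot[of F], of e] in \<open>simp_all add: sum_distrib_right[symmetric]\<close>)
    qed
    show "cmod (Z F y x) \<le> 1" for F y x
    proof -
      have "cmod (Z F y x) \<le> (\<Sum>A\<in>Pow F. cmod (1 / 2 ^ card F) * 1)"
        unfolding Z_def
        by (rule order_trans[OF norm_sum]) (simp only: norm_mult, intro sum_mono mult_left_mono z_le norm_ge_zero)
      with tot[of F] show ?thesis by simp
    qed
    \<comment> \<open>The limit is attained as soon as \<open>x\<close> lies in \<open>F\<close>:
      averaging reduces the column of \<open>U (- t)\<close> at \<open>x\<close> to its diagonal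
      entry.\<close>
    show "((\<lambda>F. Z F y x) \<longlongrightarrow> ker (U t) y x * U_diag t x) (finite_subsets_at_top UNIV)" for x y
    proof (rule tendsto_eventually)
      have "Z F y x = ker (U t) y x * U_diag t x" if F: "finite F" "x \<in> F" for F
      proof -
        have "Z F y x = (\<Sum>A\<in>Pow F. 1 / 2 ^ card F * sgn_on A x * l2inner (mult_op (sgn_on A) (u x)) (u y))"
          by (simp add: Z_def z mult.assoc)
        also have "\<dots> = l2inner (\<lambda>w. \<Sum>A\<in>Pow F. 1 / 2 ^ card F * sgn_on A x * mult_op (sgn_on A) (u x) w) (u y)"
          by (rule l2inner_sum_left[symmetric]) (auto intro: s2 u)
        also have "(\<lambda>w. \<Sum>A\<in>Pow F. 1 / 2 ^ card F * sgn_on A x * mult_op (sgn_on A) (u x) w) =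
            (\<lambda>w. U_diag t x * delta x w + 0)"
        proof
          fix w
          have "(\<Sum>A\<in>Pow F. 1 / 2 ^ card F * sgn_on A x * mult_op (sgn_on A) (u x) w) =
              (\<Sum>A\<in>Pow F. 1 / 2 ^ card F * (sgn_on A x * sgn_on A w)) * u x w"
            by (simp only: sum_distrib_left sum_distrib_right mult_op_def mult_ac)
          then show "(\<Sum>A\<in>Pow F. 1 / 2 ^ card F * sgn_on A x * mult_op (sgn_on A) (u x) w) =
              U_diag t x * delta x w + 0"
            by (simp only: sgn_on_average[OF F]) (simp add: delta_apply U_diag_def u_def)
        qed
        also have "l2inner \<dots> (u y) = U_diag t x * cnj (u y x)"
          by (simp only: l2inner_lin_left delta_l2 l2_zero u) simp
        also have "cnj (u y x) = ker (U t) y x"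
          using U_inner[OF delta_l2 delta_l2, of t x y] by (simp add: u_def ker_def)
        finally show ?thesis by (simp add: mult.commute)
      qed
      then show "\<forall>\<^sub>F F in finite_subsets_at_top UNIV. Z F y x = ker (U t) y x * U_diag t x"
        unfolding eventually_finite_subsets_at_top by (intro exI[of _ "{x}"]) auto
    qed
  qed
  then show ?thesis ..
qed

lemma U_diag_roe: "U t \<circ> mult_op (U_diag t) \<in> uniform_roe"
proof (rule appr_imp_roe[OF ulf])
  show "bounded_op (U t \<circ> mult_op (U_diag t))"
    by (intro bounded_op_comp U_bounded bounded_op_mult_op[of _ 1] U_diag_le)
  have "ker (U t \<circ> mult_op (U_diag t)) = (\<lambda>y x. ker (U t) y x * U_diag t x)"
    by (intro ext) (simp add: ker_def mult_op_delta bounded_op_scale[OF U_bounded] mult.commute[of _ "U_diag t _"])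
  then show "\<exists>r. appr (ker (U t \<circ> mult_op (U_diag t))) r e" if "0 < e" for e
    using U_diag_appr[OF that, of t] by simp
qed

lemma U_small_roe: "\<exists>d>0. \<forall>t. \<bar>t\<bar> \<le> d \<longrightarrow> U t \<in> uniform_roe"
proof -
  obtain C where C: "0 \<le> C" "\<And>t \<xi>. \<xi> \<in> l2 \<Longrightarrow> l2norm (vdiff (W t \<xi>) \<xi>) \<le> C * \<bar>t\<bar> * l2norm \<xi>"
    using W_near_id by blast
  \<comment> \<open>Chosen so that \<open>C * \<bar>t\<bar>\<close> is at most 1/2; adding 1 to
    \<open>C\<close> avoids division by zero.\<close>
  define d where "d = 1 / (2 * (C + 1))"
  have d: "0 < d" using C(1) by (simp add: d_def)
  have "U t \<in> uniform_roe" if t: "\<bar>t\<bar> \<le> d" for t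
  proof -
    have "C * \<bar>t\<bar> \<le> C * d" by (intro mult_left_mono t C)
    also have "\<dots> \<le> 1 / 2" using C(1) by (simp add: d_def field_simps)
    finally have Ct: "C * \<bar>t\<bar> \<le> 1 / 2" .
    have half: "1 / 2 \<le> cmod (U_diag t x)" for x
    proof -
      have "cmod (vdiff (W (- t) (delta x)) (delta x) x) \<le> l2norm (vdiff (W (- t) (delta x)) (delta x))"
        by (intro cmod_le_l2norm l2_vdiff bounded_op_l2[OF W_bounded] delta_l2)
      also have "\<dots> \<le> 1 / 2" using C(2)[OF delta_l2, of "- t" x] Ct by simp
      \<comment> \<open>\<open>U_diag t\<close> is the diagonal of \<open>U (- t)\<close>, so the
        diagonal of \<open>W (- t)\<close> is its product with a phase of modulus 1. Being within
        1/2 of 1 keeps it away from 0, and the inverse is bounded by 2.\<close>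
      finally have "cmod (phase (- t) x * U_diag t x - 1) \<le> 1 / 2"
        by (simp add: vdiff_def W_delta U_diag_def delta_apply)
      moreover have "1 \<le> cmod (phase (- t) x * U_diag t x - 1) + cmod (phase (- t) x * U_diag t x)"
        using norm_triangle_ineq4[of "phase (- t) x * U_diag t x" "phase (- t) x * U_diag t x - 1"] by simp
      ultimately show ?thesis by (simp add: norm_mult)
    qed
    define m where "m x = inverse (U_diag t x)" for x
    have "cmod (m x) \<le> 2" for x
      using half[of x] le_imp_inverse_le[OF half[of x]] by (simp add: m_def norm_inverse)
    then have "mult_op m \<in> uniform_roe" by (rule mult_op_roe)
    then have "U t \<circ> mult_op (U_diag t) \<circ> mult_op m \<in> uniform_roe" by (intro comp_roe U_diag_roe)
    moreover have "mult_op (U_diag t) (mult_op m \<xi>) = \<xi>" for \<xi>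
    proof
      fix x
      have "U_diag t x \<noteq> 0" using half[of x] by auto
      then show "mult_op (U_diag t) (mult_op m \<xi>) x = \<xi> x" by (simp add: mult_op_def m_def)
    qed
    ultimately show ?thesis by (simp add: comp_def)
  qed
  with d show ?thesis by blast
qed

lemma U_roe: "U t \<in> uniform_roe"
proof -
  obtain d where d: "0 < d" "\<And>t. \<bar>t\<bar> \<le> d \<Longrightarrow> U t \<in> uniform_roe" using U_small_roe by blast
  have mult: "U (real n * s) \<in> uniform_roe" if s: "U s \<in> uniform_roe" for n s
  proof (induction n)
    case 0
    \<comment> \<open>\<open>U 0\<close> is the identity on \<open>l2\<close> only, hence the detour
      through \<open>roe_cong\<close>.\<close>
    have "op_eq (U 0) (restr UNIV)" by (simp add: op_eq_def U_zero restr_def)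
    then show ?case using roe_cong[OF restr_roe] by simp
  next
    case (Suc n)
    have "op_eq (U (real (Suc n) * s)) (U s \<circ> U (real n * s))"
      using U_add[of _ s "real n * s"] by (simp add: op_eq_def algebra_simps)
    then show ?case using roe_cong[OF comp_roe[OF s Suc.IH]] by blast
  qed
  obtain n :: nat where n: "\<bar>t\<bar> / d < real n" using reals_Archimedean2 by blast
  have n0: "0 < real n" using n d(1) by (metis abs_ge_zero divide_nonneg_pos le_less_trans)
  have "\<bar>t / real n\<bar> \<le> d" using n n0 d(1) by (simp add: field_simps)
  from mult[OF d(2)[OF this], of n] show ?thesis using n0 by simp
qed

section \<open>The cocycle\<close>

lemma W_roe: "W t \<in> uniform_roe"
  unfolding W_def by (intro comp_roe U_roe mult_op_roe[of _ 1]) simp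

text \<open>\<open>phase\<close> carries the minus sign of the right factor of \<open>W\<close>, so
  the flow has \<open>- t\<close> on the left.\<close>

lemma diag_flow_phase: "diag_flow (diag_exp h) t a = mult_op (phase (- t)) \<circ> a \<circ> mult_op (phase t)"
  by (simp add: diag_flow_def phase_def[abs_def])

lemma mult_phase_inverse [simp]:
  "mult_op (phase t) (mult_op (phase (- t)) \<xi>) = \<xi>" "mult_op (phase (- t)) (mult_op (phase t) \<xi>) = \<xi>"
  by (simp_all add: mult_op_def mult.assoc[symmetric])

lemma mult_phase_norm: "\<xi> \<in> l2 \<Longrightarrow> l2norm (mult_op (phase t) \<xi>) = l2norm \<xi>"
  by (simp add: l2norm_def mult_op_def norm_mult)

lemma W_adjoint: "is_adjoint (W t) (mult_op (phase (- t)) \<circ> U (- t))"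
proof -
  have "is_adjoint (mult_op (phase t)) (mult_op (phase (- t)))"
    using is_adjoint_mult_op[of "phase t"] by (simp add: cnj_phase)
  then show ?thesis
    unfolding W_def by (intro is_adjoint_comp U_adjoint U_bounded bounded_op_mult_op[of _ 1]) simp_all
qed

lemma W_unitary: "unitary_op (W t)"
  unfolding unitary_op_def
proof (intro conjI exI)
  show "bounded_op (W t)" by (rule W_bounded)
  show "bounded_op (mult_op (phase (- t)) \<circ> U (- t))"
    by (intro bounded_op_comp U_bounded bounded_op_mult_op[of _ 1]) simp
  show "is_adjoint (W t) (mult_op (phase (- t)) \<circ> U (- t))" by (rule W_adjoint)
  show "op_eq (W t \<circ> (mult_op (phase (- t)) \<circ> U (- t))) id"
    by (simp add: op_eq_def W_def U_inverse)
  show "op_eq (mult_op (phase (- t)) \<circ> U (- t) \<circ> W t) id"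
    using U_inverse[of _ "- t"] by (simp add: op_eq_def W_def mult_phase_l2)
qed

text \<open>The phases of \<open>W t\<close> cancel against the left phases of the flow, leaving
  \<open>U t\<close>, \<open>U s\<close> and the product of both phases.\<close>

lemma W_cocycle: "op_eq (W (t + s)) (W t \<circ> diag_flow (diag_exp h) t (W s))"
proof -
  have "mult_op (phase (t + s)) \<xi> = mult_op (phase s) (mult_op (phase t) \<xi>)" for \<xi>
    by (simp add: mult_op_def phase_add mult_ac)
  then show ?thesis by (simp add: op_eq_def W_def diag_flow_phase U_add mult_phase_l2)
qed

lemma W_continuous: "((\<lambda>s. opnorm (\<lambda>\<xi>. vdiff (W s \<xi>) (W t \<xi>))) \<longlongrightarrow> 0) (at t)"
proof -
  obtain C where C: "0 \<le> C" "\<And>t \<xi>. \<xi> \<in> l2 \<Longrightarrow> l2norm (vdiff (W t \<xi>) \<xi>) \<le> C * \<bar>t\<bar> * l2norm \<xi>"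
    using W_near_id by blast
  have le: "opnorm (\<lambda>\<xi>. vdiff (W s \<xi>) (W t \<xi>)) \<le> C * \<bar>s - t\<bar>" for s
  proof (rule opnorm_le)
    fix \<xi> :: "'a vec" assume \<xi>: "\<xi> \<in> l2"
    define \<eta> where "\<eta> = mult_op (phase t) \<xi>"
    have \<eta>: "\<eta> \<in> l2" by (simp add: \<eta>_def mult_phase_l2 \<xi>)
    \<comment> \<open>This reduces continuity at \<open>t\<close> to the estimate near 0: outer
      factors are isometric, so \<open>C\<close> is a Lipschitz constant.\<close>
    have "W s \<xi> = U t (W (s - t) \<eta>)"
    proof -
      have "mult_op (phase s) \<xi> = mult_op (phase (s - t)) \<eta>"
        using phase_add[of "s - t" t] by (simp add: \<eta>_def mult_op_def mult_ac)
      then show ?thesis using U_add[of _ t "s - t"] \<eta> by (simp add: W_def mult_phase_l2)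
    qed
    moreover have "W t \<xi> = U t \<eta>" by (simp add: W_def \<eta>_def)
    ultimately have "vdiff (W s \<xi>) (W t \<xi>) = U t (vdiff (W (s - t) \<eta>) \<eta>)"
      by (simp add: bounded_op_diff[OF U_bounded] \<eta> bounded_op_l2[OF W_bounded])
    then have "l2norm (vdiff (W s \<xi>) (W t \<xi>)) = l2norm (vdiff (W (s - t) \<eta>) \<eta>)"
      by (simp add: U_norm l2_vdiff \<eta> bounded_op_l2[OF W_bounded])
    also have "\<dots> \<le> C * \<bar>s - t\<bar> * l2norm \<eta>" by (rule C(2)[OF \<eta>])
    finally show "l2norm (vdiff (W s \<xi>) (W t \<xi>)) \<le> C * \<bar>s - t\<bar> * l2norm \<xi>"
      by (simp add: \<eta>_def mult_phase_norm \<xi>)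
  qed (use C(1) in simp)
  have "((\<lambda>s. C * \<bar>s - t\<bar>) \<longlongrightarrow> C * \<bar>t - t\<bar>) (at t)" by (intro tendsto_intros)
  then have "((\<lambda>s. C * \<bar>s - t\<bar>) \<longlongrightarrow> 0) (at t)" by simp
  then show ?thesis
    by (rule Lim_null_comparison[rotated])
      (use le opnorm_nonneg[OF bounded_op_vdiff[OF W_bounded W_bounded]] in simp)
qed

text \<open>\<open>w\<close> is an arbitrary adjoint; uniqueness identifies it on \<open>l2\<close>
  with phases after \<open>U (- t)\<close>, and all phases cancel.\<close>

lemma W_conjugation:
  assumes a: "a \<in> uniform_roe" and w: "is_adjoint (W t) w"
  shows "op_eq (U t \<circ> a \<circ> U (- t)) (W t \<circ> diag_flow (diag_exp h) t a \<circ> w)"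
  using adjoint_unique[OF w W_adjoint]
  by (simp add: op_eq_def W_def diag_flow_phase)

lemma cocycle: "cocycle_perturbation uniform_roe (\<lambda>t a. U t \<circ> a \<circ> U (- t)) (diag_flow (diag_exp h))"
  unfolding cocycle_perturbation_def
  by (intro exI[of _ W] conjI allI ballI impI W_roe W_unitary W_continuous W_cocycle W_conjugation) auto

end

theorem theorem1p4p3:
  fixes Dh :: "'a::metric_space vec set" and h :: "'a op" and U :: "real \<Rightarrow> 'a op"
  assumes "unif_locally_finite TYPE('a)"
    and "property_A TYPE('a)"
    and "self_adjoint_unb Dh h"
    and "coarse_operator Dh h"
    and "is_exp_ith Dh h U"
    and "\<forall>t. (\<forall>a\<in>uniform_roe. U t \<circ> a \<circ> U (- t) \<in> uniform_roe) \<and>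
             (\<forall>b\<in>uniform_roe. \<exists>a\<in>uniform_roe. op_eq b (U t \<circ> a \<circ> U (- t)))"
  shows "coarse_map (diag_exp h) \<and>
         cocycle_perturbation uniform_roe (\<lambda>t a. U t \<circ> a \<circ> U (- t)) (diag_flow (diag_exp h))"
proof -
  interpret coarse_flow Dh h U
    using assms by unfold_locales simp_all
  show ?thesis using coarse_map_diag_exp cocycle by simp
qed

end
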